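(* Consider the setting described in the context, with the saddle operator $\boldsymbol{\mathcal S}\colon\boldsymbol{\mathsf X}\to 2^{\boldsymbol{\mathsf X}}$, the set $\mathscr P$ of solutions to the primal inclusion (P), the set $\mathscr D$ of solutions to the dual inclusion (D), and the Kuhn--Tucker set $\mathsf Z$. Then the following hold: (i) $\boldsymbol{\mathcal S}$ is maximally monotone. (ii) $\operatorname{zer}\boldsymbol{\mathcal S}$ is closed and convex. (iii) If $(\overline{\boldsymbol x},\overline{\boldsymbol y},\overline{\boldsymbol z},\overline{\boldsymbol v}^* )\in\operatorname{zer}\boldsymbol{\mathcal S}$, then $(\overline{\boldsymbol x},\overline{\boldsymbol v}^* )\in\mathsf Z$; moreover $\mathsf Z\subset\mathscr P\times\mathscr D$. (iv) $\mathscr D\neq\varnothing\Leftrightarrow\operatorname{zer}\boldsymbol{\mathcal S}\neq\varnothing\Leftrightarrow\mathsf Z\neq\varnothing$, and these imply $\mathscr P\neq\varnothing$. (v) Suppose that one of the following holds: [a] $I$ is a singleton. [b] For every $k\in K$, $(B_k^{\rm m}+B_k^{\rm c}+B_k^{\rm l})\,\square\,(D_k^{\rm m}+D_k^{\rm c}+D_k^{\rm l})$ is at most single-valued. [c] For every $k\in K$, $(D_k^{\rm m}+D_k^{\rm c}+D_k^{\rm l})^{-1}$ is strictly monotone. [d] $I\subset K$, the operators $\big((B_k^{\rm m}+B_k^{\rm c}+B_k^{\rm l})\,\square\,(D_k^{\rm m}+D_k^{\rm c}+D_k^{\rm l})\big)_{k\in K\smallsetminus I}$ are at most single-valued, and,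 for all $i\in I$ and $k\in I$, $k\neq i\Rightarrow L_{ki}=0$. Then $\mathscr P\neq\varnothing\Rightarrow\mathsf Z\neq\varnothing$.
   Context: Notation. For a set-valued operator $A\colon\mathcal K\to 2^{\mathcal K}$ on a real Hilbert space, $A^{-1}$ is the set-valued inverse and $\operatorname{zer}A=\{x\mid 0\in Ax\}$. The parallel sum of $B,D\colon\mathcal K\to 2^{\mathcal K}$ is $B\,\square\,D=(B^{-1}+D^{-1})^{-1}$. $C\colon\mathcal K\to\mathcal K$ is cocoercive with constant $\alpha>0$ if $\langle x-y\mid Cx-Cy\rangle\geq\alpha\|Cx-Cy\|^2$ for all $x,y$. Setting. $(\mathcal H_i)_{i\in I}$ and $(\mathcal G_k)_{k\in K}$ are finite families of real Hilbert spaces, with Hilbert direct sums $\boldsymbol{\mathcal H}=\bigoplus_{i\in I}\mathcal H_i$ and $\boldsymbol{\mathcal G}=\bigoplus_{k\in K}\mathcal G_k$; $\boldsymbol x=(x_i)_{i\in I}$ denotes a generic element of $\boldsymbol{\mathcal H}$. For every $i\in I$ and $k\in K$, $s_i^*\in\mathcal H_i$, $r_k\in\mathcal G_k$, and: [a] $A_i\colon\mathcal H_i\to 2^{\mathcal H_i}$ is maximally monotone, $C_i\colon\mathcal H_i\to\mathcal H_i$ is cocoercive with constant $\alpha_i^{\rm c}\in(0,+\infty)$, $Q_i\colon\mathcal H_i\to\mathcal H_i$ is monotone and Lipschitzian with constant $\alpha_i^{\rm l}\in[0,+\infty)$, and $R_i\colon\boldsymbol{\mathcal H}\to\mathcal H_i$.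 [b] $B_k^{\rm m}\colon\mathcal G_k\to 2^{\mathcal G_k}$ is maximally monotone, $B_k^{\rm c}\colon\mathcal G_k\to\mathcal G_k$ is cocoercive with constant $\beta_k^{\rm c}\in(0,+\infty)$, $B_k^{\rm l}\colon\mathcal G_k\to\mathcal G_k$ is monotone and Lipschitzian with constant $\beta_k^{\rm l}\in[0,+\infty)$. [c] $D_k^{\rm m}\colon\mathcal G_k\to 2^{\mathcal G_k}$ is maximally monotone, $D_k^{\rm c}\colon\mathcal G_k\to\mathcal G_k$ is cocoercive with constant $\delta_k^{\rm c}\in(0,+\infty)$, $D_k^{\rm l}\colon\mathcal G_k\to\mathcal G_k$ is monotone and Lipschitzian with constant $\delta_k^{\rm l}\in[0,+\infty)$. [d] $L_{ki}\colon\mathcal H_i\to\mathcal G_k$ is linear and bounded. [e] $\boldsymbol R\colon\boldsymbol{\mathcal H}\to\boldsymbol{\mathcal H}\colon\boldsymbol x\mapsto(R_i\boldsymbol x)_{i\in I}$ is monotone and Lipschitzian with constant $\chi\in[0,+\infty)$. (P): find $\overline{\boldsymbol x}\in\boldsymbol{\mathcal H}$ such that, for every $i\in I$, $$s_i^*\in A_i\overline x_i+C_i\overline x_i+Q_i\overline x_i+R_i\overline{\boldsymbol x}+\sum_{k\in K}L_{ki}^*\Big(\big((B_k^{\rm m}+B_k^{\rm c}+B_k^{\rm l})\,\square\,(D_k^{\rm m}+D_k^{\rm c}+D_k^{\rm l})\big)\Big(\sum_{j\in I}L_{kj}\overline x_j-r_k\Big)\Big).$$ (D): find $\overline{\boldsymbol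 v}^*\in\boldsymbol{\mathcal G}$ such that there exists $\boldsymbol x\in\boldsymbol{\mathcal H}$ with, for all $i\in I$, $k\in K$, $$s_i^*-\sum_{j\in K}L_{ji}^*\overline v_j^*\in A_ix_i+C_ix_i+Q_ix_i+R_i\boldsymbol x,\qquad \overline v_k^*\in\big((B_k^{\rm m}+B_k^{\rm c}+B_k^{\rm l})\,\square\,(D_k^{\rm m}+D_k^{\rm c}+D_k^{\rm l})\big)\Big(\sum_{j\in I}L_{kj}x_j-r_k\Big).$$ Kuhn--Tucker set: $\mathsf Z$ is the set of $(\overline{\boldsymbol x},\overline{\boldsymbol v}^* )\in\boldsymbol{\mathcal H}\oplus\boldsymbol{\mathcal G}$ such that, for all $i\in I$, $k\in K$, $s_i^*-\sum_{j\in K}L_{ji}^*\overline v_j^*\in A_i\overline x_i+C_i\overline x_i+Q_i\overline x_i+R_i\overline{\boldsymbol x}$ and $\sum_{j\in I}L_{kj}\overline x_j-r_k\in(B_k^{\rm m}+B_k^{\rm c}+B_k^{\rm l})^{-1}\overline v_k^*+(D_k^{\rm m}+D_k^{\rm c}+D_k^{\rm l})^{-1}\overline v_k^*$. Saddle operator: with $\boldsymbol{\mathsf X}=\boldsymbol{\mathcal H}\oplus\boldsymbol{\mathcal G}\oplus\boldsymbol{\mathcal G}\oplus\boldsymbol{\mathcal G}$, $\boldsymbol{\mathcal S}\colon\boldsymbol{\mathsf X}\to2^{\boldsymbol{\mathsf X}}$ maps $(\boldsymbol x,\boldsymbol y,\boldsymbol z,\boldsymbol v^* )$ to the Cartesian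 product of the four sets $\times_{i\in I}\big(-s_i^*+A_ix_i+C_ix_i+Q_ix_i+R_i\boldsymbol x+\sum_{k\in K}L_{ki}^*v_k^*\big)$, $\times_{k\in K}\big(B_k^{\rm m}y_k+B_k^{\rm c}y_k+B_k^{\rm l}y_k-v_k^*\big)$, $\times_{k\in K}\big(D_k^{\rm m}z_k+D_k^{\rm c}z_k+D_k^{\rm l}z_k-v_k^*\big)$, $\times_{k\in K}\big\{r_k+y_k+z_k-\sum_{i\in I}L_{ki}x_i\big\}$. *)

theory Defs
  imports "HOL-Analysis.Analysis"
begin

text \<open>
  A finite family of real Hilbert spaces, whose members may all be different, is represented by
  closed linear subspaces \<open>H i\<close> (for \<open>i \<in> I\<close>) of one ambient Hilbert space. This is no loss of
  generality: every such family embeds isometrically into its own Hilbert direct sum.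
  An operator on a space \<open>S\<close> is a function on the ambient type of which only the values on the
  carrier \<open>S\<close> matter; all notions below are therefore relativised to a carrier.
  The symbol \<open>+\<close> between sets, and sums of sets, are Minkowski sums (a sum over an empty index set
  is \<open>{0}\<close>). Beware that \<open>-\<close> between sets is set difference and is never used for translations.
\<close>

subsection \<open>Set-valued operators on a carrier\<close>

definition monotone_op :: "'a::real_inner set \<Rightarrow> ('a \<Rightarrow> 'a set) \<Rightarrow> bool" where
  "monotone_op S A \<longleftrightarrow> (\<forall>x\<in>S. \<forall>y\<in>S. \<forall>u\<in>A x. \<forall>v\<in>A y. 0 \<le> (x - y) \<bullet> (u - v))"

text \<open>Maximality: no monotone operator on \<open>S\<close> has a graph properly containing that of \<open>A\<close>.\<close>

definition maximally_monotone :: "'a::real_inner set \<Rightarrow> ('a \<Rightarrow> 'a set) \<Rightarrow> bool" where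
  "maximally_monotone S A \<longleftrightarrow>
     (\<forall>x\<in>S. A x \<subseteq> S) \<and> monotone_op S A \<and>
     (\<forall>B. (\<forall>x\<in>S. B x \<subseteq> S) \<and> monotone_op S B \<and> (\<forall>x\<in>S. A x \<subseteq> B x)
        \<longrightarrow> (\<forall>x\<in>S. B x = A x))"

definition strictly_monotone_op :: "'a::real_inner set \<Rightarrow> ('a \<Rightarrow> 'a set) \<Rightarrow> bool" where
  "strictly_monotone_op S A \<longleftrightarrow>
     (\<forall>x\<in>S. \<forall>y\<in>S. \<forall>u\<in>A x. \<forall>v\<in>A y. x \<noteq> y \<longrightarrow> 0 < (x - y) \<bullet> (u - v))"

definition at_most_single_valued :: "'a set \<Rightarrow> ('a \<Rightarrow> 'b set) \<Rightarrow> bool" where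
  "at_most_single_valued S A \<longleftrightarrow> (\<forall>x\<in>S. \<forall>u\<in>A x. \<forall>v\<in>A x. u = v)"

definition inverse_op :: "'a set \<Rightarrow> ('a \<Rightarrow> 'b set) \<Rightarrow> 'b \<Rightarrow> 'a set" where
  "inverse_op S A u = {x\<in>S. u \<in> A x}"

definition zer :: "'a::zero set \<Rightarrow> ('a \<Rightarrow> 'a set) \<Rightarrow> 'a set" where
  "zer S A = {x\<in>S. 0 \<in> A x}"

definition parallel_sum ::
  "'a::comm_monoid_add set \<Rightarrow> ('a \<Rightarrow> 'a set) \<Rightarrow> ('a \<Rightarrow> 'a set) \<Rightarrow> 'a \<Rightarrow> 'a set" where
  "parallel_sum S B D = inverse_op S (\<lambda>u. inverse_op S B u + inverse_op S D u)"

definition cocoercive :: "'a::real_inner set \<Rightarrow> real \<Rightarrow> ('a \<Rightarrow> 'a) \<Rightarrow> bool" where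
  "cocoercive S \<alpha> C \<longleftrightarrow>
     (\<forall>x\<in>S. \<forall>y\<in>S. \<alpha> * (norm (C x - C y))\<^sup>2 \<le> (x - y) \<bullet> (C x - C y))"


subsection \<open>Bounded linear operators between subspaces, and their adjoints\<close>

definition bounded_linear_between ::
  "'a::real_normed_vector set \<Rightarrow> 'b::real_normed_vector set \<Rightarrow> ('a \<Rightarrow> 'b) \<Rightarrow> bool" where
  "bounded_linear_between S T L \<longleftrightarrow>
     L \<in> S \<rightarrow> T \<and>
     (\<forall>x\<in>S. \<forall>y\<in>S. L (x + y) = L x + L y) \<and>
     (\<forall>c. \<forall>x\<in>S. L (c *\<^sub>R x) = c *\<^sub>R L x) \<and>
     (\<exists>M. \<forall>x\<in>S. norm (L x) \<le> M * norm x)"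

text \<open>
  The adjoint has to take values in the domain \<open>S\<close> of \<open>L\<close>; it is then unique, and it exists
  for bounded linear \<open>L\<close> and closed \<open>S\<close> by the Riesz representation theorem.
\<close>

definition adjoint_on :: "'a::real_inner set \<Rightarrow> ('a \<Rightarrow> 'b::real_inner) \<Rightarrow> 'b \<Rightarrow> 'a" where
  "adjoint_on S L v = (THE u. u \<in> S \<and> (\<forall>x\<in>S. x \<bullet> u = L x \<bullet> v))"


subsection \<open>Hilbert direct sums\<close>

text \<open>
  The product of the sets \<open>F i\<close>, \<open>i \<in> I\<close>, inside \<open>'a ^ 'n\<close>; the index set \<open>I\<close> is a subset of the
  finite type \<open>'n\<close>, and the irrelevant components outside \<open>I\<close> are set to zero. When the \<open>F i\<close> are
  closed subspaces, this is the Hilbert direct sum, since the inner product of \<open>'a ^ 'n\<close> is the sum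
  of the componentwise inner products.
\<close>

definition family_prod :: "'n::finite set \<Rightarrow> ('n \<Rightarrow> 'a::zero set) \<Rightarrow> ('a ^ 'n) set" where
  "family_prod I F = {x. (\<forall>i\<in>I. x $ i \<in> F i) \<and> (\<forall>i. i \<notin> I \<longrightarrow> x $ i = 0)}"


subsection \<open>The primal and dual problems, the Kuhn--Tucker set and the saddle operator\<close>

text \<open>
  Below, \<open>M i x\<close> stands for the set $A_i x_i + C_i x_i + Q_i x_i + R_i x$, \<open>B k\<close> and \<open>D k\<close> for the sums
  of the three operators with superscripts m, c, l, and \<open>T k\<close> for the parallel sum of \<open>B k\<close>
  and \<open>D k\<close>.
\<close>

definition primal_solutions ::
  "'n::finite set \<Rightarrow> 'n set \<Rightarrow> ('n \<Rightarrow> 'h::real_inner set) \<Rightarrow>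
   ('n \<Rightarrow> 'h) \<Rightarrow> ('n \<Rightarrow> 'g::real_inner) \<Rightarrow> ('n \<Rightarrow> 'n \<Rightarrow> 'h \<Rightarrow> 'g) \<Rightarrow>
   ('n \<Rightarrow> 'h ^ 'n \<Rightarrow> 'h set) \<Rightarrow> ('n \<Rightarrow> 'g \<Rightarrow> 'g set) \<Rightarrow> ('h ^ 'n) set" where
  "primal_solutions I K H s r L M T =
     {x \<in> family_prod I H. \<forall>i\<in>I.
        s i \<in> M i x + (\<Sum>k\<in>K. adjoint_on (H i) (L k i) ` T k ((\<Sum>j\<in>I. L k j (x $ j)) - r k))}"

definition dual_solutions ::
  "'n::finite set \<Rightarrow> 'n set \<Rightarrow> ('n \<Rightarrow> 'h::real_inner set) \<Rightarrow> ('n \<Rightarrow> 'g::real_inner set) \<Rightarrow>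
   ('n \<Rightarrow> 'h) \<Rightarrow> ('n \<Rightarrow> 'g) \<Rightarrow> ('n \<Rightarrow> 'n \<Rightarrow> 'h \<Rightarrow> 'g) \<Rightarrow>
   ('n \<Rightarrow> 'h ^ 'n \<Rightarrow> 'h set) \<Rightarrow> ('n \<Rightarrow> 'g \<Rightarrow> 'g set) \<Rightarrow> ('g ^ 'n) set" where
  "dual_solutions I K H G s r L M T =
     {v \<in> family_prod K G. \<exists>x\<in>family_prod I H.
        (\<forall>i\<in>I. s i - (\<Sum>j\<in>K. adjoint_on (H i) (L j i) (v $ j)) \<in> M i x) \<and>
        (\<forall>k\<in>K. v $ k \<in> T k ((\<Sum>j\<in>I. L k j (x $ j)) - r k))}"

definition kuhn_tucker_set ::
  "'n::finite set \<Rightarrow> 'n set \<Rightarrow> ('n \<Rightarrow> 'h::real_inner set) \<Rightarrow> ('n \<Rightarrow> 'g::real_inner set) \<Rightarrow>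
   ('n \<Rightarrow> 'h) \<Rightarrow> ('n \<Rightarrow> 'g) \<Rightarrow> ('n \<Rightarrow> 'n \<Rightarrow> 'h \<Rightarrow> 'g) \<Rightarrow>
   ('n \<Rightarrow> 'h ^ 'n \<Rightarrow> 'h set) \<Rightarrow> ('n \<Rightarrow> 'g \<Rightarrow> 'g set) \<Rightarrow> ('n \<Rightarrow> 'g \<Rightarrow> 'g set) \<Rightarrow>
   (('h ^ 'n) \<times> ('g ^ 'n)) set" where
  "kuhn_tucker_set I K H G s r L M B D =
     {(x, v) \<in> family_prod I H \<times> family_prod K G.
        (\<forall>i\<in>I. s i - (\<Sum>j\<in>K. adjoint_on (H i) (L j i) (v $ j)) \<in> M i x) \<and>
        (\<forall>k\<in>K. (\<Sum>j\<in>I. L k j (x $ j)) - r k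
                 \<in> inverse_op (G k) (B k) (v $ k) + inverse_op (G k) (D k) (v $ k))}"

definition saddle_op ::
  "'n::finite set \<Rightarrow> 'n set \<Rightarrow> ('n \<Rightarrow> 'h::real_inner set) \<Rightarrow>
   ('n \<Rightarrow> 'h) \<Rightarrow> ('n \<Rightarrow> 'g::real_inner) \<Rightarrow> ('n \<Rightarrow> 'n \<Rightarrow> 'h \<Rightarrow> 'g) \<Rightarrow>
   ('n \<Rightarrow> 'h ^ 'n \<Rightarrow> 'h set) \<Rightarrow> ('n \<Rightarrow> 'g \<Rightarrow> 'g set) \<Rightarrow> ('n \<Rightarrow> 'g \<Rightarrow> 'g set) \<Rightarrow>
   ('h ^ 'n) \<times> ('g ^ 'n) \<times> ('g ^ 'n) \<times> ('g ^ 'n) \<Rightarrow>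
   (('h ^ 'n) \<times> ('g ^ 'n) \<times> ('g ^ 'n) \<times> ('g ^ 'n)) set" where
  "saddle_op I K H s r L M B D = (\<lambda>(x, y, z, v).
       family_prod I (\<lambda>i. {- s i} + M i x + {\<Sum>k\<in>K. adjoint_on (H i) (L k i) (v $ k)})
     \<times> family_prod K (\<lambda>k. B k (y $ k) + {- (v $ k)})
     \<times> family_prod K (\<lambda>k. D k (z $ k) + {- (v $ k)})
     \<times> family_prod K (\<lambda>k. {r k + y $ k + z $ k - (\<Sum>i\<in>I. L k i (x $ i))}))"

end

theory Submission
  imports Defs
begin

text \<open>
  Everything rests on Minty's theorem: a maximally monotone operator \<open>A\<close> on a Hilbert space
  satisfies \<open>0 \<in> x + A x\<close> for some \<open>x\<close>. It is obtained here (\<open>minty_zero\<close>) by minimizing the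
  sum of the Fitzpatrick function of \<open>A\<close> and half the squared norm. This sum is strongly convex,
  so a minimizer exists by completeness alone, and its optimality condition forces the desired point to lie on the graph.
  The same minimization gives the Riesz representation and hence the adjoints.

  Minty's theorem implies that adding a monotone Lipschitzian operator preserves maximal
  monotonicity (\<open>maximally_monotone_add_lipschitz\<close>); cocoercive operators are of this kind. The
  saddle operator arises from the given maximally monotone operators by two constructions under
  which maximality is stable: products, and additions of such perturbations. The perturbations
  are the cocoercive and Lipschitzian terms of each space, the coupling operator on the direct
  sum of the \<open>H i\<close>, and an affine map whose linear part is skew
  (\<open>maximally_monotone_saddle_op\<close>). The zeros of a maximally monotone operator form an
  intersection of closed half-spaces with the carrier, whence closedness and convexity.

  The remaining claims are set algebra. The Kuhn--Tucker set is the projection of the zeros of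
  the saddle operator (\<open>kuhn_tucker_set_iff_zer_saddle_op\<close>), and its own projection to the dual
  space is exactly the set of dual solutions. A primal solution differs from a Kuhn--Tucker point
  only in that its dual vectors may depend on the index \<open>i\<close>; each of the four coupling
  hypotheses removes this dependence (\<open>kuhn_tucker_set_nonempty_of_primal\<close>).
\<close>

section \<open>Minimizing a strongly convex function\<close>

text \<open>
  The set \<open>E\<close> plays the role of the epigraph of a closed convex function \<open>\<phi>\<close>. Adding
  \<open>(norm z)\<^sup>2 / 2\<close> makes the objective strongly convex, so by the parallelogram identity every
  minimizing sequence is Cauchy and completeness yields a minimizer without any weak compactness.
  The conclusion is the optimality condition \<open>- z0 \<in> \<partial>\<phi> z0\<close>. It serves twice: \<open>\<phi>\<close> is
  the Fitzpatrick function in Minty's theorem, and minus a bounded linear functional in the Riesz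
  representation. Working with a set instead of \<open>\<phi>\<close> avoids the value \<open>+\<infinity>\<close>.
\<close>

lemma closed_convex_epigraph_proximal_point:
  fixes E :: "('a::{real_inner, complete_space} \<times> real) set"
  assumes "closed E" and "convex E" and "E \<noteq> {}"
    and low: "\<And>z t. (z, t) \<in> E \<Longrightarrow> m \<le> t + (norm z)\<^sup>2 / 2"
  obtains z0 t0 where "(z0, t0) \<in> E" and "\<And>z t. (z, t) \<in> E \<Longrightarrow> t0 \<le> t + z0 \<bullet> (z - z0)"
proof -
  define g where "g e = snd e + (norm (fst e))\<^sup>2 / 2" for e :: "'a \<times> real"
  define \<mu> where "\<mu> = Inf (g ` E)"
  have bdd: "bdd_below (g ` E)"
    using low by (auto simp: g_def intro!: bdd_belowI2[where m=m])
  have \<mu>_le: "\<mu> \<le> g e" if "e \<in> E" for e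
    unfolding \<mu>_def using that bdd by (intro cInf_lower) auto
  have "\<exists>e\<in>E. g e < \<mu> + inverse (real (Suc n))" for n
    using cInf_lessD[of "g ` E" "\<mu> + inverse (real (Suc n))"] assms(3) by (auto simp: \<mu>_def)
  then obtain e where eE: "\<And>n. e n \<in> E" and e: "\<And>n. g (e n) < \<mu> + inverse (real (Suc n))"
    by metis
  have g_lim: "(\<lambda>n. g (e n)) \<longlonglongrightarrow> \<mu>"
  proof (rule tendsto_sandwich[where f = "\<lambda>_. \<mu>" and h = "\<lambda>n. \<mu> + inverse (real (Suc n))"])
    show "(\<lambda>n. \<mu> + inverse (real (Suc n))) \<longlonglongrightarrow> \<mu>"
      using tendsto_add[OF tendsto_const LIMSEQ_inverse_real_of_nat, of \<mu>] by simp
    show "\<forall>\<^sub>F n in sequentially. g (e n) \<le> \<mu> + inverse (real (Suc n))"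
      using e by (intro always_eventually allI less_imp_le)
  qed (use eE \<mu>_le in auto)
  \<comment> \<open>The objective at the midpoint of \<open>p\<close> and \<open>q\<close> is still at least \<open>\<mu>\<close>.\<close>
  have mid: "(norm (fst p - fst q))\<^sup>2 \<le> 4 * (g p + g q - 2 * \<mu>)" if "p \<in> E" "q \<in> E" for p q
  proof -
    have "(1/2) *\<^sub>R p + (1/2) *\<^sub>R q \<in> E"
      using assms(2) that by (auto simp: convex_def)
    then have "\<mu> \<le> g ((1/2) *\<^sub>R p + (1/2) *\<^sub>R q)" by (rule \<mu>_le)
    also have "\<dots> = (g p + g q) / 2 - (norm (fst p - fst q))\<^sup>2 / 8"
      unfolding g_def power2_norm_eq_inner
      by (simp add: algebra_simps inner_commute, argo)
    finally show ?thesis by argo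
  qed
  have "Cauchy (\<lambda>n. fst (e n))"
  proof (rule metric_CauchyI)
    fix \<epsilon> :: real assume "0 < \<epsilon>"
    then obtain N where N: "inverse (real (Suc N)) < \<epsilon>\<^sup>2 / 8"
      using reals_Archimedean[of "\<epsilon>\<^sup>2 / 8"] by auto
    have "dist (fst (e p)) (fst (e q)) < \<epsilon>" if "N \<le> p" "N \<le> q" for p q
    proof -
      have "inverse (real (Suc p)) < \<epsilon>\<^sup>2 / 8" "inverse (real (Suc q)) < \<epsilon>\<^sup>2 / 8"
        using N that le_imp_inverse_le[of "real (Suc N)"] by (smt (verit) of_nat_0_less_iff of_nat_mono Suc_le_mono zero_less_Suc)+
      then have "(norm (fst (e p) - fst (e q)))\<^sup>2 < \<epsilon>\<^sup>2"
        using mid[OF eE eE, of p q] e[of p] e[of q] by argo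
      then show ?thesis
        using \<open>0 < \<epsilon>\<close> by (auto simp: dist_norm intro: power_less_imp_less_base)
    qed
    then show "\<exists>M. \<forall>p\<ge>M. \<forall>q\<ge>M. dist (fst (e p)) (fst (e q)) < \<epsilon>" by blast
  qed
  then obtain z0 where z0: "(\<lambda>n. fst (e n)) \<longlonglongrightarrow> z0"
    using Cauchy_convergent convergent_def by blast
  define t0 where "t0 = \<mu> - (norm z0)\<^sup>2 / 2"
  have "(\<lambda>n. g (e n) - (norm (fst (e n)))\<^sup>2 / 2) \<longlonglongrightarrow> t0"
    unfolding t0_def by (intro tendsto_intros g_lim z0) auto
  then have "(\<lambda>n. snd (e n)) \<longlonglongrightarrow> t0" by (simp add: g_def)
  with z0 have "(\<lambda>n. (fst (e n), snd (e n))) \<longlonglongrightarrow> (z0, t0)" by (rule tendsto_Pair)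
  then have mem: "(z0, t0) \<in> E"
    using closed_sequentially[OF assms(1), of e] eE by simp
  have "t0 \<le> t + z0 \<bullet> (z - z0)" if "(z, t) \<in> E" for z t
  proof -
    \<comment> \<open>The first-order part of the objective along the segment from the minimizer to \<open>(z, t)\<close>.\<close>
    define c where "c = t - t0 + z0 \<bullet> (z - z0)"
    have ineq: "0 \<le> c + \<theta> * ((norm (z - z0))\<^sup>2 / 2)" if \<theta>: "0 < \<theta>" "\<theta> < 1" for \<theta>
    proof -
      have "(1 - \<theta>) *\<^sub>R (z0, t0) + \<theta> *\<^sub>R (z, t) \<in> E"
        using convexD[OF assms(2) mem \<open>(z, t) \<in> E\<close>, of "1 - \<theta>" \<theta>] \<theta> by simp
      from \<mu>_le[OF this] have "\<mu> \<le> \<mu> + \<theta> * (c + \<theta> * ((norm (z - z0))\<^sup>2 / 2))"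
        unfolding g_def c_def t0_def power2_norm_eq_inner
        by (simp add: algebra_simps inner_commute, argo)
      then have "0 \<le> \<theta> * (c + \<theta> * ((norm (z - z0))\<^sup>2 / 2))" by simp
      then show ?thesis using \<theta> by (simp add: zero_le_mult_iff)
    qed
    have "((\<lambda>\<theta>. c + \<theta> * ((norm (z - z0))\<^sup>2 / 2)) \<longlongrightarrow> c + 0 * ((norm (z - z0))\<^sup>2 / 2)) (at_right 0)"
      by (intro tendsto_intros)
    moreover have "eventually (\<lambda>\<theta>. 0 \<le> c + \<theta> * ((norm (z - z0))\<^sup>2 / 2)) (at_right 0)"
      unfolding eventually_at_right_field using ineq zero_less_one by blast
    ultimately have "0 \<le> c" using tendsto_lowerbound by fastforce
    then show ?thesis by (simp add: c_def)
  qed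
  with mem show thesis by (rule that)
qed

section \<open>Maximal monotonicity and Minty's theorem\<close>

text \<open>
  A monotone extension of the graph contains extensions by single points, so maximality only has
  to be tested against these.
\<close>

lemma maximally_monotone_iff:
  "maximally_monotone S A \<longleftrightarrow>
     (\<forall>x\<in>S. A x \<subseteq> S) \<and> monotone_op S A \<and>
     (\<forall>x\<in>S. \<forall>u\<in>S. (\<forall>y\<in>S. \<forall>v\<in>A y. 0 \<le> (x - y) \<bullet> (u - v)) \<longrightarrow> u \<in> A x)"
  (is "?lhs \<longleftrightarrow> ?S \<and> ?mono \<and> ?max")
proof
  assume L: ?lhs
  then have S: ?S and mono: ?mono
    and max: "\<And>B. (\<forall>x\<in>S. B x \<subseteq> S) \<Longrightarrow> monotone_op S B \<Longrightarrow> (\<forall>x\<in>S. A x \<subseteq> B x) \<Longrightarrow> (\<forall>x\<in>S. B x = A x)"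
    unfolding maximally_monotone_def by blast+
  have ?max
  proof (intro ballI impI)
    fix x u assume xu: "x \<in> S" "u \<in> S" and rel: "\<forall>y\<in>S. \<forall>v\<in>A y. 0 \<le> (x - y) \<bullet> (u - v)"
    define B where "B = A(x := insert u (A x))"
    have flip: "(y - x) \<bullet> (v - u) = (x - y) \<bullet> (u - v)" for y v
      by (simp add: algebra_simps)
    have mB: "monotone_op S B"
      using mono rel xu unfolding monotone_op_def B_def
      by (auto simp: flip split: if_splits)
    have "\<forall>y\<in>S. B y = A y"
    proof (rule max[OF _ mB])
      show "\<forall>y\<in>S. B y \<subseteq> S" using S xu by (auto simp: B_def)
      show "\<forall>y\<in>S. A y \<subseteq> B y" by (auto simp: B_def)
    qed
    with xu have "B x = A x" by blast
    then show "u \<in> A x" by (auto simp: B_def)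
  qed
  with S mono show "?S \<and> ?mono \<and> ?max" by blast
next
  assume R: "?S \<and> ?mono \<and> ?max"
  have "B x = A x" if B: "\<forall>x\<in>S. B x \<subseteq> S" "monotone_op S B" "\<forall>x\<in>S. A x \<subseteq> B x" and x: "x \<in> S" for B x
  proof
    show "B x \<subseteq> A x"
    proof
      fix u assume u: "u \<in> B x"
      then have "\<forall>y\<in>S. \<forall>v\<in>A y. 0 \<le> (x - y) \<bullet> (u - v)"
        using B x unfolding monotone_op_def by blast
      then show "u \<in> A x" using R B x u by blast
    qed
  qed (use that in blast)
  then show ?lhs using R unfolding maximally_monotone_def by blast
qed

text \<open>
  Minty's theorem at the point \<open>0\<close>, in the form \<open>0 \<in> x + A x\<close>. The Fitzpatrick function
  \<open>\<phi> (x, u) = (SUP (a, a') \<in> gra A. x \<bullet> a' + a \<bullet> u - a \<bullet> a')\<close>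
  is convex, equals \<open>a \<bullet> a'\<close> on the graph and, by maximality, is bounded below by the
  duality pairing \<open>x \<bullet> u\<close>. Hence \<open>\<phi> (x, u) + (norm (x, u))\<^sup>2 / 2\<close> is at least
  \<open>(norm (x + u))\<^sup>2 / 2 \<ge> 0\<close>. Testing the optimality condition at a minimizer \<open>(x, u)\<close>
  against graph points shows that \<open>(- u, - x)\<close> is monotonically related to the graph, so it
  lies on it; testing against that very point gives \<open>u = - x\<close>.
\<close>

lemma minty_zero:
  fixes S :: "'a::{real_inner, complete_space} set"
  assumes "subspace S" "closed S" and A: "maximally_monotone S A"
  obtains x where "x \<in> S" "- x \<in> A x"
proof -
  have AS: "\<And>x u. x \<in> S \<Longrightarrow> u \<in> A x \<Longrightarrow> u \<in> S"
    and mono: "\<And>x y u v. x \<in> S \<Longrightarrow> y \<in> S \<Longrightarrow> u \<in> A x \<Longrightarrow> v \<in> A y \<Longrightarrow> 0 \<le> (x - y) \<bullet> (u - v)"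
    and max: "\<And>x u. x \<in> S \<Longrightarrow> u \<in> S \<Longrightarrow> (\<And>y v. y \<in> S \<Longrightarrow> v \<in> A y \<Longrightarrow> 0 \<le> (x - y) \<bullet> (u - v)) \<Longrightarrow> u \<in> A x"
    using A unfolding maximally_monotone_iff monotone_op_def by blast+
  \<comment> \<open>The epigraph of the Fitzpatrick function, restricted to the carrier.\<close>
  define E where "E = {p :: ('a \<times> 'a) \<times> real. fst (fst p) \<in> S \<and> snd (fst p) \<in> S \<and>
     (\<forall>a\<in>S. \<forall>a'\<in>A a. fst (fst p) \<bullet> a' + a \<bullet> snd (fst p) - a \<bullet> a' \<le> snd p)}"
  have E_iff: "((x, u), t) \<in> E \<longleftrightarrow> x \<in> S \<and> u \<in> S \<and> (\<forall>a\<in>S. \<forall>a'\<in>A a. x \<bullet> a' + a \<bullet> u - a \<bullet> a' \<le> t)" for x u t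
    by (simp add: E_def)
  have gra: "((a, a'), a \<bullet> a') \<in> E" if "a \<in> S" "a' \<in> A a" for a a'
    unfolding E_iff using that AS mono[of _ a] by (force simp: algebra_simps inner_commute)
  obtain a1 a1' where "a1 \<in> S" "a1' \<in> A a1"
    using max[of 0 0] subspace_0[OF assms(1)] by blast
  then have "E \<noteq> {}" using gra by blast
  moreover have "closed E"
  proof -
    have "E = ({p. fst (fst p) \<in> S} \<inter> {p. snd (fst p) \<in> S}) \<inter>
       (\<Inter>a\<in>S. \<Inter>a'\<in>A a. {p. fst (fst p) \<bullet> a' + a \<bullet> snd (fst p) - a \<bullet> a' \<le> snd p})"
      by (auto simp: E_def)
    moreover have "closed {p :: ('a \<times> 'a) \<times> real. fst (fst p) \<in> S}" "closed {p :: ('a \<times> 'a) \<times> real. snd (fst p) \<in> S}"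
      using continuous_closed_vimage[OF assms(2), of "\<lambda>p :: ('a \<times> 'a) \<times> real. fst (fst p)"]
        continuous_closed_vimage[OF assms(2), of "\<lambda>p :: ('a \<times> 'a) \<times> real. snd (fst p)"]
      by (auto simp: vimage_def)
    moreover have "closed {p :: ('a \<times> 'a) \<times> real. fst (fst p) \<bullet> a' + a \<bullet> snd (fst p) - a \<bullet> a' \<le> snd p}" for a a'
      by (intro closed_Collect_le continuous_intros)
    ultimately show ?thesis by (auto intro!: closed_Int closed_INT)
  qed
  moreover have "convex E"
  proof (rule convexI)
    fix p q :: "('a \<times> 'a) \<times> real" and \<alpha> \<beta> :: real
    assume pq: "p \<in> E" "q \<in> E" and ab: "0 \<le> \<alpha>" "0 \<le> \<beta>" "\<alpha> + \<beta> = 1"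
    show "\<alpha> *\<^sub>R p + \<beta> *\<^sub>R q \<in> E"
      unfolding E_def
    proof (intro CollectI conjI ballI)
      fix a a' assume a: "a \<in> S" "a' \<in> A a"
      have "\<alpha> * (fst (fst p) \<bullet> a' + a \<bullet> snd (fst p) - a \<bullet> a') + \<beta> * (fst (fst q) \<bullet> a' + a \<bullet> snd (fst q) - a \<bullet> a')
         \<le> \<alpha> * snd p + \<beta> * snd q"
        using pq a ab by (intro add_mono mult_left_mono) (auto simp: E_def)
      moreover have "a \<bullet> a' = \<alpha> * (a \<bullet> a') + \<beta> * (a \<bullet> a')"
        using ab by (simp flip: distrib_right)
      ultimately show "fst (fst (\<alpha> *\<^sub>R p + \<beta> *\<^sub>R q)) \<bullet> a' + a \<bullet> snd (fst (\<alpha> *\<^sub>R p + \<beta> *\<^sub>R q)) - a \<bullet> a'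
         \<le> snd (\<alpha> *\<^sub>R p + \<beta> *\<^sub>R q)"
        by (simp add: inner_add_left inner_add_right right_diff_distrib distrib_left)
    qed (use pq assms(1) in \<open>auto simp: E_def intro!: subspace_add subspace_scale\<close>)
  qed
  \<comment> \<open>Otherwise \<open>(x, u)\<close> is strictly related to every graph point, hence in the graph by
    maximality, and so strictly related to itself.\<close>
  moreover have fitz: "x \<bullet> u \<le> t" if "((x, u), t) \<in> E" for x u t
  proof (rule ccontr)
    assume "\<not> x \<bullet> u \<le> t"
    with that have xu: "x \<in> S" "u \<in> S"
      and lt: "\<And>a a'. a \<in> S \<Longrightarrow> a' \<in> A a \<Longrightarrow> x \<bullet> a' + a \<bullet> u - a \<bullet> a' < x \<bullet> u"
      unfolding E_iff by fastforce+
    have "u \<in> A x"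
      using xu by (rule max) (use lt in \<open>force simp: algebra_simps\<close>)
    from lt[OF xu(1) this] show False by simp
  qed
  have sq: "(norm (x + u))\<^sup>2 = (norm x)\<^sup>2 + (norm u)\<^sup>2 + 2 * (x \<bullet> u)" for x u :: 'a
    by (simp add: power2_norm_eq_inner algebra_simps inner_commute)
  have nP: "(norm (x, u))\<^sup>2 = (norm x)\<^sup>2 + (norm u)\<^sup>2" for x u :: 'a
    by (simp add: norm_Pair)
  have low: "0 \<le> t + (norm z)\<^sup>2 / 2" if "(z, t) \<in> E" for z t
    using fitz[of "fst z" "snd z" t] that sq[of "fst z" "snd z"] nP[of "fst z" "snd z"]
      zero_le_power2[of "norm (fst z + snd z)"]
    by (simp del: zero_le_power2, argo)
  ultimately obtain z0 t0 where z0: "(z0, t0) \<in> E"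
    and vi: "\<And>z t. (z, t) \<in> E \<Longrightarrow> t0 \<le> t + z0 \<bullet> (z - z0)"
    using closed_convex_epigraph_proximal_point[of E 0] by metis
  obtain x u where z0_eq: "z0 = (x, u)" by fastforce
  have key: "(norm (x + u))\<^sup>2 / 2 \<le> (a + u) \<bullet> (a' + x)" if "a \<in> S" "a' \<in> A a" for a a'
    using vi[OF gra[OF that]] low[OF z0] sq[of x u] nP[of x u] unfolding z0_eq
    by (simp add: algebra_simps inner_commute power2_norm_eq_inner, argo)
  have "- x \<in> A (- u)"
  proof (rule max)
    show "- u \<in> S" "- x \<in> S"
      using z0 assms(1) by (auto simp: z0_eq E_iff intro: subspace_neg)
    show "0 \<le> (- u - y) \<bullet> (- x - v)" if "y \<in> S" "v \<in> A y" for y v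
    proof -
      have "0 \<le> (norm (x + u))\<^sup>2 / 2" by simp
      also have "\<dots> \<le> (y + u) \<bullet> (v + x)" by (rule key[OF that])
      also have "\<dots> = (- u - y) \<bullet> (- x - v)" by (simp add: algebra_simps)
      finally show ?thesis .
    qed
  qed
  moreover from z0 have "- u \<in> S" using assms(1) by (auto simp: z0_eq E_iff intro: subspace_neg)
  ultimately have "(norm (x + u))\<^sup>2 \<le> 0" using key[of "- u" "- x"] by simp
  then have "- u = x" by (intro minus_unique) (simp add: add.commute)
  with \<open>- u \<in> S\<close> \<open>- x \<in> A (- u)\<close> show thesis by (intro that) auto
qed

lemma maximally_monotone_cong:
  assumes "\<And>x. x \<in> S \<Longrightarrow> A x = B x"
  shows "maximally_monotone S A \<longleftrightarrow> maximally_monotone S B"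
  using assms unfolding maximally_monotone_iff monotone_op_def by simp

text \<open>
  The only point to check is that a \<open>u\<close> related to the graph vanishes: test it at \<open>x + u\<close>.
  This operator is the set-valued part of the saddle operator in its last coordinate.
\<close>

lemma maximally_monotone_const_0:
  assumes "subspace S"
  shows "maximally_monotone S (\<lambda>_. {0})"
  unfolding maximally_monotone_iff
proof (intro conjI ballI impI)
  fix x u assume xu: "x \<in> S" "u \<in> S" and rel: "\<forall>y\<in>S. \<forall>v\<in>{0}. 0 \<le> (x - y) \<bullet> (u - v)"
  have "0 \<le> (x - (x + u)) \<bullet> (u - 0)"
    using rel subspace_add[OF assms xu] by blast
  then have "u \<bullet> u \<le> 0" by simp
  then show "u \<in> {0}" using inner_ge_zero[of u] by (metis antisym inner_eq_zero_iff singletonI)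
qed (use assms in \<open>auto simp: monotone_op_def subspace_0\<close>)

lemma maximally_monotone_affine:
  assumes "subspace S" and A: "maximally_monotone S A" and "0 < c" and "q \<in> S"
  shows "maximally_monotone S (\<lambda>x. (\<lambda>w. c *\<^sub>R w + q) ` A x)"
  unfolding maximally_monotone_iff
proof (intro conjI ballI impI)
  show "(\<lambda>w. c *\<^sub>R w + q) ` A x \<subseteq> S" if "x \<in> S" for x
    using that assms by (auto simp: maximally_monotone_iff intro!: subspace_add subspace_scale)
  show "monotone_op S (\<lambda>x. (\<lambda>w. c *\<^sub>R w + q) ` A x)"
  proof -
    have "0 \<le> (x - y) \<bullet> ((c *\<^sub>R u + q) - (c *\<^sub>R v + q))"
      if "x \<in> S" "y \<in> S" "u \<in> A x" "v \<in> A y" for x y u v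
    proof -
      have "0 \<le> c * ((x - y) \<bullet> (u - v))"
        using that A \<open>0 < c\<close> by (simp add: maximally_monotone_iff monotone_op_def)
      then show ?thesis by (simp add: algebra_simps)
    qed
    then show ?thesis by (auto simp: monotone_op_def)
  qed
next
  fix x u assume xu: "x \<in> S" "u \<in> S"
    and rel: "\<forall>y\<in>S. \<forall>v\<in>(\<lambda>w. c *\<^sub>R w + q) ` A y. 0 \<le> (x - y) \<bullet> (u - v)"
  define w where "w = (1 / c) *\<^sub>R (u - q)"
  have u: "u = c *\<^sub>R w + q" using \<open>0 < c\<close> by (simp add: w_def)
  have "w \<in> S" unfolding w_def using assms xu by (intro subspace_scale subspace_diff)
  moreover have "0 \<le> (x - y) \<bullet> (w - v)" if "y \<in> S" "v \<in> A y" for y v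
  proof -
    have "0 \<le> (x - y) \<bullet> (u - (c *\<^sub>R v + q))" using rel that by blast
    also have "\<dots> = c * ((x - y) \<bullet> (w - v))" by (simp add: u algebra_simps)
    finally show ?thesis using \<open>0 < c\<close> by (simp add: zero_le_mult_iff)
  qed
  ultimately have "w \<in> A x" using A xu unfolding maximally_monotone_iff by blast
  then show "u \<in> (\<lambda>w. c *\<^sub>R w + q) ` A x" using u by blast
qed

text \<open>
  The general surjectivity statement follows from the case of the point \<open>0\<close> by scaling and
  translating the values of the operator.
\<close>

lemma minty_resolvent:
  fixes S :: "'a::{real_inner, complete_space} set"
  assumes "subspace S" "closed S" "maximally_monotone S A" "0 < c" "p \<in> S"
  obtains a a' where "a \<in> S" "a' \<in> A a" "p = a + c *\<^sub>R a'"
proof -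
  have "maximally_monotone S (\<lambda>x. (\<lambda>w. c *\<^sub>R w + (- p)) ` A x)"
    using assms by (intro maximally_monotone_affine) (auto intro: subspace_neg)
  from minty_zero[OF assms(1,2) this] obtain a a'
    where "a \<in> S" "a' \<in> A a" "- a = c *\<^sub>R a' + (- p)" by blast
  moreover from this(3) have "p = a + c *\<^sub>R a'"
    by (simp add: algebra_simps add_eq_0_iff neg_eq_iff_add_eq_0)
  ultimately show thesis using that by blast
qed

section \<open>Monotone Lipschitzian perturbations\<close>

lemma mem_plus_singleton_iff: "x \<in> X + {a} \<longleftrightarrow> x - a \<in> X"
  for x a :: "'a::ab_group_add"
  using set_plus_intro[of "x - a" X a "{a}"] by (auto elim!: set_plus_elim)

lemma mem_singleton_plus_plus_singleton_iff: "x \<in> {a} + X + {b} \<longleftrightarrow> x - b - a \<in> X"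
  for x a b :: "'a::ab_group_add"
  unfolding mem_plus_singleton_iff add.commute[of "{a}" X] ..

text \<open>
  Let \<open>(x, u)\<close> be monotonically related to the graph of the sum. Minty's theorem provides
  \<open>(a, a')\<close> in the graph of \<open>A\<close> with \<open>a + c a' = x + c (u - F x)\<close>; inserting this point in the
  relation gives \<open>(norm (x - a))\<^sup>2 \<le> c b (norm (x - a))\<^sup>2\<close>. A step size with
  \<open>c b < 1\<close> forces \<open>a = x\<close>, hence \<open>u - F x = a' \<in> A x\<close>.
\<close>

lemma maximally_monotone_add_lipschitz:
  fixes S :: "'a::{real_inner, complete_space} set"
  assumes S: "subspace S" "closed S" and A: "maximally_monotone S A"
    and F: "F \<in> S \<rightarrow> S" and mono: "monotone_op S (\<lambda>x. {F x})" and lip: "b-lipschitz_on S F"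
  shows "maximally_monotone S (\<lambda>x. A x + {F x})"
  unfolding maximally_monotone_iff
proof (intro conjI ballI impI)
  show "A x + {F x} \<subseteq> S" if "x \<in> S" for x
    using that S A F by (auto simp: maximally_monotone_iff elim!: set_plus_elim intro!: subspace_add)
  show "monotone_op S (\<lambda>x. A x + {F x})"
    unfolding monotone_op_def
  proof (intro ballI)
    fix x y u' v' assume xy: "x \<in> S" "y \<in> S" and "u' \<in> A x + {F x}" "v' \<in> A y + {F y}"
    then obtain u v where uv: "u \<in> A x" "v \<in> A y" and eq: "u' = u + F x" "v' = v + F y"
      by (auto elim!: set_plus_elim)
    have "0 \<le> (x - y) \<bullet> (u - v)" "0 \<le> (x - y) \<bullet> (F x - F y)"
      using A mono xy uv by (auto simp: maximally_monotone_iff monotone_op_def)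
    then show "0 \<le> (x - y) \<bullet> (u' - v')" by (simp add: eq algebra_simps)
  qed
next
  fix x u assume xu: "x \<in> S" "u \<in> S" and rel: "\<forall>y\<in>S. \<forall>v\<in>A y + {F y}. 0 \<le> (x - y) \<bullet> (u - v)"
  \<comment> \<open>The summand \<open>1\<close> keeps the step size finite when \<open>b = 0\<close>.\<close>
  define c where "c = 1 / (b + 1)"
  have b: "0 \<le> b" using lip by (rule lipschitz_on_nonneg)
  then have c: "0 < c" "c * b < 1" by (auto simp: c_def field_simps)
  have "x + c *\<^sub>R (u - F x) \<in> S"
    using xu F S by (intro subspace_add subspace_scale subspace_diff) auto
  from minty_resolvent[OF S A c(1) this] obtain a a'
    where a: "a \<in> S" "a' \<in> A a" and p: "x + c *\<^sub>R (u - F x) = a + c *\<^sub>R a'" .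
  have eq: "c *\<^sub>R (a' - (u - F x)) = x - a" using p by (simp add: algebra_simps)
  have "0 \<le> (x - a) \<bullet> (u - (a' + F a))" using rel a by blast
  then have "0 \<le> c * ((x - a) \<bullet> (u - (a' + F a)))" using c by simp
  also have "\<dots> = c * ((x - a) \<bullet> (F x - F a)) - (x - a) \<bullet> (c *\<^sub>R (a' - (u - F x)))"
    by (simp add: algebra_simps)
  also have "\<dots> \<le> c * (b * (norm (x - a))\<^sup>2) - (norm (x - a))\<^sup>2"
  proof -
    have "(x - a) \<bullet> (F x - F a) \<le> norm (x - a) * norm (F x - F a)" by (rule norm_cauchy_schwarz)
    also have "\<dots> \<le> norm (x - a) * (b * norm (x - a))"
      using lipschitz_on_normD[OF lip xu(1) a(1)] by (intro mult_left_mono) auto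
    finally have "(x - a) \<bullet> (F x - F a) \<le> b * (norm (x - a))\<^sup>2"
      by (simp add: power2_eq_square algebra_simps)
    then show ?thesis
      using c unfolding eq by (simp add: power2_norm_eq_inner)
  qed
  finally have "(1 - c * b) * (norm (x - a))\<^sup>2 \<le> 0" by (simp add: algebra_simps)
  then have "(norm (x - a))\<^sup>2 \<le> 0" using c by (simp add: mult_le_0_iff)
  then have "x = a" by simp
  then have "a' = u - F x" using eq c by simp
  with a \<open>x = a\<close> have "u - F x \<in> A x" by simp
  then have "(u - F x) + F x \<in> A x + {F x}" by blast
  then show "u \<in> A x + {F x}" by simp
qed

lemma cocoercive_imp_monotone_op:
  assumes "cocoercive S \<alpha> C" "0 < \<alpha>"
  shows "monotone_op S (\<lambda>x. {C x})"
  unfolding monotone_op_def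
proof (intro ballI)
  fix x y u v assume "x \<in> S" "y \<in> S" "u \<in> {C x}" "v \<in> {C y}"
  then have "\<alpha> * (norm (C x - C y))\<^sup>2 \<le> (x - y) \<bullet> (u - v)"
    using assms(1) by (simp add: cocoercive_def)
  moreover have "0 \<le> \<alpha> * (norm (C x - C y))\<^sup>2" using assms(2) by simp
  ultimately show "0 \<le> (x - y) \<bullet> (u - v)" by linarith
qed

text \<open>
  Cauchy--Schwarz turns cocoercivity into a Lipschitz bound, so the cocoercive terms are
  covered by the perturbation result as well.
\<close>

lemma cocoercive_imp_lipschitz_on:
  assumes "cocoercive S \<alpha> C" "0 < \<alpha>"
  shows "(1 / \<alpha>)-lipschitz_on S C"
proof (rule lipschitz_onI)
  fix x y assume "x \<in> S" "y \<in> S"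
  then have "\<alpha> * (norm (C x - C y))\<^sup>2 \<le> norm (x - y) * norm (C x - C y)"
    using assms(1) norm_cauchy_schwarz[of "x - y" "C x - C y"] unfolding cocoercive_def by force
  then have "norm (C x - C y) * (\<alpha> * norm (C x - C y)) \<le> norm (C x - C y) * norm (x - y)"
    by (simp add: power2_eq_square algebra_simps)
  then have "\<alpha> * norm (C x - C y) \<le> norm (x - y)"
    by (metis mult_left_le_imp_le mult_zero_right norm_ge_zero order_le_less)
  then show "dist (C x) (C y) \<le> 1 / \<alpha> * dist x y"
    using assms(2) by (simp add: dist_norm field_simps)
qed (use assms(2) in simp)

lemma maximally_monotone_add_cocoercive_add_lipschitz:
  fixes S :: "'a::{real_inner, complete_space} set"
  assumes "subspace S \<and> closed S" and "maximally_monotone S A"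
    and "C \<in> S \<rightarrow> S \<and> 0 < \<alpha> \<and> cocoercive S \<alpha> C"
    and "Q \<in> S \<rightarrow> S \<and> monotone_op S (\<lambda>x. {Q x}) \<and> b-lipschitz_on S Q"
  shows "maximally_monotone S (\<lambda>x. A x + {C x} + {Q x})"
proof (rule maximally_monotone_add_lipschitz)
  show "maximally_monotone S (\<lambda>x. A x + {C x})"
    using assms(1-3)
    by (intro maximally_monotone_add_lipschitz[where b = "1 / \<alpha>"] cocoercive_imp_monotone_op[where \<alpha> = \<alpha>]
        cocoercive_imp_lipschitz_on) auto
qed (use assms in auto)

section \<open>The set of zeros\<close>

text \<open>
  Maximality expresses membership of \<open>0\<close> by inequalities that are affine in \<open>x\<close>: the zeros
  are an intersection of the carrier with closed half-spaces.
\<close>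

lemma maximally_monotone_zer:
  assumes "subspace S" and A: "maximally_monotone S A"
  shows "zer S A = S \<inter> (\<Inter>y\<in>S. \<Inter>v\<in>A y. {x. x \<bullet> v \<le> y \<bullet> v})"
proof -
  have "0 \<in> A x \<longleftrightarrow> (\<forall>y\<in>S. \<forall>v\<in>A y. 0 \<le> (x - y) \<bullet> (0 - v))" if "x \<in> S" for x
    using assms that unfolding maximally_monotone_iff monotone_op_def
    by (meson subspace_0)
  then show ?thesis by (auto simp: zer_def inner_diff_left)
qed

lemma closed_convex_zer:
  assumes "subspace S" "closed S" and "maximally_monotone S A"
  shows "closed (zer S A) \<and> convex (zer S A)"
proof -
  have "closed {x. x \<bullet> v \<le> y \<bullet> v}" "convex {x. x \<bullet> v \<le> y \<bullet> v}" for v y :: 'a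
    using closed_halfspace_le[of v "y \<bullet> v"] convex_halfspace_le[of v "y \<bullet> v"]
    by (simp_all add: inner_commute)
  then show ?thesis
    unfolding maximally_monotone_zer[OF assms(1,3)]
    using assms by (intro conjI closed_Int closed_INT convex_Int convex_INT ballI subspace_imp_convex[OF assms(1)]) auto
qed

section \<open>Products of maximally monotone operators\<close>

lemma subspace_family_prod:
  assumes "\<And>i. i \<in> I \<Longrightarrow> subspace (H i)"
  shows "subspace (family_prod I H)"
  using assms by (auto simp: subspace_def family_prod_def)

lemma closed_family_prod:
  fixes H :: "'n::finite \<Rightarrow> 'a::{t1_space, zero} set"
  assumes "\<And>i. i \<in> I \<Longrightarrow> closed (H i)"
  shows "closed (family_prod I H)"
proof -
  have "family_prod I H = (\<Inter>i. (\<lambda>x. x $ i) -` (if i \<in> I then H i else {0}))"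
    by (auto simp: family_prod_def split: if_splits)
  moreover have "closed ((\<lambda>x. x $ i) -` (if i \<in> I then H i else {0}))" for i
    using assms by (intro continuous_closed_vimage continuous_intros) auto
  ultimately show ?thesis by (auto intro: closed_INT)
qed

lemma zero_mem_family_prod_iff: "0 \<in> family_prod I F \<longleftrightarrow> (\<forall>i\<in>I. 0 \<in> F i)"
  by (simp add: family_prod_def)

lemma mem_family_prod_singleton_iff:
  "u \<in> family_prod I (\<lambda>i. {e i}) \<longleftrightarrow> u = (\<chi> i. if i \<in> I then e i else 0)"
  by (auto simp: family_prod_def vec_eq_iff)

lemma inner_family_prod:
  assumes "x \<in> family_prod I F"
  shows "x \<bullet> y = (\<Sum>i\<in>I. x $ i \<bullet> y $ i)"
  unfolding inner_vec_def using assms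
  by (intro sum.mono_neutral_right) (auto simp: family_prod_def)

text \<open>
  If \<open>u\<close> fails to belong to the product in some coordinates, choose in each of them a graph
  point that violates monotonicity, and \<open>(x $ i, u $ i)\<close> itself in the remaining ones. These
  assemble to one point of the product graph at which the inner product, a sum over the
  coordinates, is negative.
\<close>

lemma maximally_monotone_family_prod:
  fixes H :: "'n::finite \<Rightarrow> 'a::real_inner set"
  assumes H: "\<And>i. i \<in> I \<Longrightarrow> subspace (H i)" and A: "\<And>i. i \<in> I \<Longrightarrow> maximally_monotone (H i) (A i)"
  shows "maximally_monotone (family_prod I H) (\<lambda>x. family_prod I (\<lambda>i. A i (x $ i)))"
  unfolding maximally_monotone_iff
proof (intro conjI ballI impI)
  have sub: "subspace (family_prod I H)" using H by (rule subspace_family_prod)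
  have inner: "(x - y) \<bullet> w = (\<Sum>i\<in>I. (x $ i - y $ i) \<bullet> w $ i)"
    if "x \<in> family_prod I H" "y \<in> family_prod I H" for x y w
    using inner_family_prod[OF subspace_diff[OF sub that], of w] by simp
  show "family_prod I (\<lambda>i. A i (x $ i)) \<subseteq> family_prod I H" if "x \<in> family_prod I H" for x
    using that A by (fastforce simp: family_prod_def maximally_monotone_iff)
  show "monotone_op (family_prod I H) (\<lambda>x. family_prod I (\<lambda>i. A i (x $ i)))"
    unfolding monotone_op_def
  proof (intro ballI)
    fix x y u v assume "x \<in> family_prod I H" "y \<in> family_prod I H"
      "u \<in> family_prod I (\<lambda>i. A i (x $ i))" "v \<in> family_prod I (\<lambda>i. A i (y $ i))"
    then show "0 \<le> (x - y) \<bullet> (u - v)"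
      using A by (auto simp: inner family_prod_def maximally_monotone_iff monotone_op_def intro!: sum_nonneg)
  qed
  fix x u assume xu: "x \<in> family_prod I H" "u \<in> family_prod I H"
    and rel: "\<forall>y\<in>family_prod I H. \<forall>v\<in>family_prod I (\<lambda>i. A i (y $ i)). 0 \<le> (x - y) \<bullet> (u - v)"
  have xuH: "x $ i \<in> H i" "u $ i \<in> H i" if "i \<in> I" for i
    using xu that by (auto simp: family_prod_def)
  have "\<exists>b b'. i \<in> I \<longrightarrow> b \<in> H i \<and> b' \<in> A i b \<and> (x $ i - b) \<bullet> (u $ i - b') \<le> 0 \<and>
      (u $ i \<notin> A i (x $ i) \<longrightarrow> (x $ i - b) \<bullet> (u $ i - b') < 0)" for i
  proof (cases "i \<in> I \<and> u $ i \<notin> A i (x $ i)")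
    case True
    then obtain b b' where "b \<in> H i" "b' \<in> A i b" "\<not> 0 \<le> (x $ i - b) \<bullet> (u $ i - b')"
      using A[of i] xuH[of i] unfolding maximally_monotone_iff by blast
    then show ?thesis by (intro exI[of _ b] exI[of _ b']) auto
  next
    case False
    then show ?thesis using xuH by (intro exI[of _ "x $ i"] exI[of _ "u $ i"]) auto
  qed
  then obtain b b' where bb': "\<And>i. i \<in> I \<Longrightarrow> b i \<in> H i \<and> b' i \<in> A i (b i) \<and>
      (x $ i - b i) \<bullet> (u $ i - b' i) \<le> 0 \<and>
      (u $ i \<notin> A i (x $ i) \<longrightarrow> (x $ i - b i) \<bullet> (u $ i - b' i) < 0)" by metis
  define y where "y = (\<chi> i. if i \<in> I then b i else 0)"
  define v where "v = (\<chi> i. if i \<in> I then b' i else 0)"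
  have y: "y \<in> family_prod I H" and v: "v \<in> family_prod I (\<lambda>i. A i (y $ i))"
    using bb' by (auto simp: y_def v_def family_prod_def)
  have "0 \<le> (x - y) \<bullet> (u - v)" using rel y v by blast
  also have "\<dots> = (\<Sum>i\<in>I. (x $ i - b i) \<bullet> (u $ i - b' i))"
    using xu(1) y by (simp add: inner y_def v_def)
  finally have sum: "0 \<le> (\<Sum>i\<in>I. (x $ i - b i) \<bullet> (u $ i - b' i))" .
  have "u $ i \<in> A i (x $ i)" if "i \<in> I" for i
  proof (rule ccontr)
    assume "u $ i \<notin> A i (x $ i)"
    then have "(\<Sum>i\<in>I. (x $ i - b i) \<bullet> (u $ i - b' i)) < (\<Sum>i\<in>I. 0)"
      using bb' that by (intro sum_strict_mono_ex1) auto
    with sum show False by simp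
  qed
  then show "u \<in> family_prod I (\<lambda>i. A i (x $ i))" using xu by (auto simp: family_prod_def)
qed

lemma maximally_monotone_Times:
  assumes A: "maximally_monotone S A" and B: "maximally_monotone T B"
  shows "maximally_monotone (S \<times> T) (\<lambda>(x, y). A x \<times> B y)"
  unfolding maximally_monotone_iff
proof (intro conjI ballI impI)
  show "(case p of (x, y) \<Rightarrow> A x \<times> B y) \<subseteq> S \<times> T" if "p \<in> S \<times> T" for p
    using that A B by (fastforce simp: maximally_monotone_iff)
  show "monotone_op (S \<times> T) (\<lambda>(x, y). A x \<times> B y)"
    using A B by (fastforce simp: monotone_op_def maximally_monotone_iff intro!: add_nonneg_nonneg)
  fix p q assume pq: "p \<in> S \<times> T" "q \<in> S \<times> T"
    and rel: "\<forall>p'\<in>S \<times> T. \<forall>q'\<in>(case p' of (x, y) \<Rightarrow> A x \<times> B y). 0 \<le> (p - p') \<bullet> (q - q')"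
  obtain x y u v where p: "p = (x, y)" "q = (u, v)" by (cases p, cases q)
  have rel': "0 \<le> (x - a) \<bullet> (u - a') + (y - b) \<bullet> (v - b')"
    if "a \<in> S" "b \<in> T" "a' \<in> A a" "b' \<in> B b" for a b a' b'
    using rel[rule_format, of "(a, b)" "(a', b')"] that by (simp add: p)
  have xu: "x \<in> S" "u \<in> S" "y \<in> T" "v \<in> T" using pq by (auto simp: p)
  have "u \<in> A x"
  proof (rule ccontr)
    assume "u \<notin> A x"
    then obtain a a' where a: "a \<in> S" "a' \<in> A a" "(x - a) \<bullet> (u - a') < 0"
      using A xu unfolding maximally_monotone_iff by (meson not_le)
    have "0 \<le> (y - b) \<bullet> (v - b')" if "b \<in> T" "b' \<in> B b" for b b'
      using rel'[OF a(1) that(1) a(2) that(2)] a(3) by linarith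
    then have "v \<in> B y" using B xu unfolding maximally_monotone_iff by blast
    from rel'[OF a(1) xu(3) a(2) this] a(3) show False by simp
  qed
  moreover have "v \<in> B y"
  proof -
    have "0 \<le> (y - b) \<bullet> (v - b')" if "b \<in> T" "b' \<in> B b" for b b'
      using rel'[OF xu(1) that(1) \<open>u \<in> A x\<close> that(2)] by simp
    then show ?thesis using B xu unfolding maximally_monotone_iff by blast
  qed
  ultimately show "q \<in> (case p of (x, y) \<Rightarrow> A x \<times> B y)" by (simp add: p)
qed

text \<open>
  The operators \<open>R i\<close> depend on all coordinates and are monotone only jointly, so they can only be
  added after the product has been formed.
\<close>

lemma maximally_monotone_coupled_family_prod:
  fixes I :: "'n::finite set" and H :: "'n \<Rightarrow> 'h::{real_inner, complete_space} set"
  assumes H: "\<And>i. i \<in> I \<Longrightarrow> subspace (H i) \<and> closed (H i)"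
    and A: "\<And>i. i \<in> I \<Longrightarrow> maximally_monotone (H i) (A i)"
    and R_maps: "\<And>i. i \<in> I \<Longrightarrow> R i \<in> family_prod I H \<rightarrow> H i"
    and R_mono: "monotone_op (family_prod I H) (\<lambda>x. {\<chi> i. if i \<in> I then R i x else 0})"
    and R_lip: "chi-lipschitz_on (family_prod I H) (\<lambda>x. \<chi> i. if i \<in> I then R i x else 0)"
  shows "maximally_monotone (family_prod I H) (\<lambda>x. family_prod I (\<lambda>i. A i (x $ i) + {R i x}))"
proof -
  have "maximally_monotone (family_prod I H)
      (\<lambda>x. family_prod I (\<lambda>i. A i (x $ i)) + {\<chi> i. if i \<in> I then R i x else 0})"
  proof (rule maximally_monotone_add_lipschitz[OF _ _ _ _ R_mono R_lip])
    show "(\<lambda>x. \<chi> i. if i \<in> I then R i x else 0) \<in> family_prod I H \<rightarrow> family_prod I H"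
    proof
      fix x assume x: "x \<in> family_prod I H"
      have "R i x \<in> H i" if "i \<in> I" for i using R_maps[OF that] x by blast
      then show "(\<chi> i. if i \<in> I then R i x else 0) \<in> family_prod I H" by (simp add: family_prod_def)
    qed
  qed (use H A in \<open>auto intro!: subspace_family_prod closed_family_prod maximally_monotone_family_prod\<close>)
  moreover have "family_prod I (\<lambda>i. A i (x $ i)) + {\<chi> i. if i \<in> I then R i x else 0}
      = family_prod I (\<lambda>i. A i (x $ i) + {R i x})" for x
    by (auto simp: mem_plus_singleton_iff family_prod_def)
  ultimately show ?thesis by simp
qed

section \<open>Riesz representation and adjoints on closed subspaces\<close>

lemma bounded_linear_between_diff:
  assumes "bounded_linear_between S T L" "subspace S" "x \<in> S" "y \<in> S"
  shows "L (x - y) = L x - L y"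
proof -
  have "L (x + (-1) *\<^sub>R y) = L x + L ((-1) *\<^sub>R y)"
    using assms unfolding bounded_linear_between_def by (metis subspace_scale)
  moreover have "L ((-1) *\<^sub>R y) = (-1) *\<^sub>R L y"
    using assms unfolding bounded_linear_between_def by blast
  ultimately show ?thesis by simp
qed

lemma bounded_linear_between_lipschitz_on:
  assumes L: "bounded_linear_between S T L" and S: "subspace S"
  obtains c where "c-lipschitz_on S L"
proof -
  obtain M where M: "\<And>x. x \<in> S \<Longrightarrow> norm (L x) \<le> M * norm x"
    using L unfolding bounded_linear_between_def by blast
  have "\<bar>M\<bar>-lipschitz_on S L"
  proof (rule lipschitz_onI)
    fix x y assume xy: "x \<in> S" "y \<in> S"
    have "norm (L x - L y) \<le> M * norm (x - y)"
      using M[OF subspace_diff[OF S xy]] bounded_linear_between_diff[OF L S xy] by simp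
    also have "\<dots> \<le> \<bar>M\<bar> * norm (x - y)" by (intro mult_right_mono) auto
    finally show "dist (L x) (L y) \<le> \<bar>M\<bar> * dist x y" by (simp add: dist_norm)
  qed auto
  then show thesis by (rule that)
qed

lemma adjoint_on_eqI:
  assumes S: "subspace S" and u: "u \<in> S" "\<And>x. x \<in> S \<Longrightarrow> x \<bullet> u = L x \<bullet> v"
  shows "adjoint_on S L v = u"
  unfolding adjoint_on_def
proof (rule the_equality)
  fix w assume w: "w \<in> S \<and> (\<forall>x\<in>S. x \<bullet> w = L x \<bullet> v)"
  then have "w - u \<in> S" using S u by (auto intro: subspace_diff)
  then have "(w - u) \<bullet> (w - u) = 0" using w u(2)[of "w - u"] by (simp add: inner_diff_right)
  then show "w = u" by simp
qed (use u in auto)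

text \<open>
  The representing vector minimizes \<open>(norm x)\<^sup>2 / 2 - f x\<close> on \<open>S\<close>; its optimality condition,
  applied to \<open>x\<close> and \<open>- x\<close>, becomes an equality.
\<close>

lemma riesz_on_closed_subspace:
  fixes S :: "'a::{real_inner, complete_space} set"
  assumes S: "subspace S" "closed S" and f: "bounded_linear_between S UNIV (f :: 'a \<Rightarrow> real)"
  obtains u where "u \<in> S" "\<And>x. x \<in> S \<Longrightarrow> x \<bullet> u = f x"
proof -
  have add: "\<And>x y. x \<in> S \<Longrightarrow> y \<in> S \<Longrightarrow> f (x + y) = f x + f y"
    and scale: "\<And>c x. x \<in> S \<Longrightarrow> f (c *\<^sub>R x) = c * f x"
    using f by (auto simp: bounded_linear_between_def)
  obtain M where M: "\<And>x. x \<in> S \<Longrightarrow> \<bar>f x\<bar> \<le> M * norm x"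
    using f unfolding bounded_linear_between_def real_norm_def by blast
  \<comment> \<open>The epigraph of \<open>- f\<close> on \<open>S\<close>.\<close>
  define E where "E = {p \<in> S \<times> UNIV. 0 \<le> snd p + f (fst p)}"
  have E_iff: "(z, t) \<in> E \<longleftrightarrow> z \<in> S \<and> - f z \<le> t" for z t by (auto simp: E_def)
  obtain c where "c-lipschitz_on S f"
    using bounded_linear_between_lipschitz_on[OF f S(1)] .
  then have "continuous_on S f" by (rule lipschitz_on_continuous_on)
  then have "continuous_on (S \<times> UNIV) (\<lambda>p :: 'a \<times> real. snd p + f (fst p))"
    by (intro continuous_on_add continuous_on_snd continuous_on_id
        continuous_on_compose2[of S f _ fst] continuous_on_fst) auto
  then have "closed ((S \<times> UNIV) \<inter> (\<lambda>p :: 'a \<times> real. snd p + f (fst p)) -` {0..})"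
    by (rule continuous_closed_preimage) (use S(2) in \<open>auto intro: closed_Times\<close>)
  moreover have "E = (S \<times> UNIV) \<inter> (\<lambda>p. snd p + f (fst p)) -` {0..}" by (auto simp: E_def)
  ultimately have "closed E" by simp
  moreover have "convex E"
  proof (rule convexI)
    fix p q :: "'a \<times> real" and \<alpha> \<beta> :: real
    assume pq: "p \<in> E" "q \<in> E" and ab: "0 \<le> \<alpha>" "0 \<le> \<beta>" "\<alpha> + \<beta> = 1"
    then have pqS: "fst p \<in> S" "fst q \<in> S" by (auto simp: E_def)
    have "0 \<le> \<alpha> * (snd p + f (fst p)) + \<beta> * (snd q + f (fst q))"
      using pq ab by (auto simp: E_def)
    then show "\<alpha> *\<^sub>R p + \<beta> *\<^sub>R q \<in> E"
      using pqS S(1) by (simp add: E_def mem_Times_iff add scale subspace_add subspace_scale algebra_simps)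
  qed
  moreover have "(0, - f 0) \<in> E" using subspace_0[OF S(1)] by (simp add: E_iff)
  moreover have "- M\<^sup>2 / 2 \<le> t + (norm z)\<^sup>2 / 2" if "(z, t) \<in> E" for z t
  proof -
    have "- (M * norm z) \<le> t" using that M[of z] by (auto simp: E_iff)
    moreover have "0 \<le> (norm z - M)\<^sup>2" by simp
    ultimately show ?thesis by (simp add: power2_diff, argo)
  qed
  ultimately obtain u t0 where "(u, t0) \<in> E"
    and vi: "\<And>z t. (z, t) \<in> E \<Longrightarrow> t0 \<le> t + u \<bullet> (z - u)"
    using closed_convex_epigraph_proximal_point[of E "- M\<^sup>2 / 2"] by blast
  then have u: "u \<in> S" and "- f u \<le> t0" by (auto simp: E_iff)
  have le: "f x \<le> u \<bullet> x" if "x \<in> S" for x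
  proof -
    have "(u + x, - f (u + x)) \<in> E" using subspace_add[OF S(1) u that] by (simp add: E_iff)
    from vi[OF this] show ?thesis using \<open>- f u \<le> t0\<close> add[OF u that] by simp
  qed
  have "x \<bullet> u = f x" if "x \<in> S" for x
    using le[OF that] le[OF subspace_neg[OF S(1) that]] scale[OF that, of "-1"]
    by (simp add: inner_commute)
  with u show thesis by (rule that)
qed

text \<open>
  The Riesz representation makes the definite description in the definition of the adjoint
  denote.
\<close>

lemma adjoint_on_characterization:
  fixes S :: "'a::{real_inner, complete_space} set"
  assumes S: "subspace S" "closed S" and L: "bounded_linear_between S T L"
  shows "adjoint_on S L v \<in> S" and "\<And>x. x \<in> S \<Longrightarrow> x \<bullet> adjoint_on S L v = L x \<bullet> v"
proof -
  obtain M where M: "\<And>x. x \<in> S \<Longrightarrow> norm (L x) \<le> M * norm x"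
    using L unfolding bounded_linear_between_def by blast
  have "\<bar>L x \<bullet> v\<bar> \<le> (M * norm v) * norm x" if "x \<in> S" for x
  proof -
    have "\<bar>L x \<bullet> v\<bar> \<le> norm (L x) * norm v" by (rule Cauchy_Schwarz_ineq2)
    also have "\<dots> \<le> M * norm x * norm v" using M[OF that] by (intro mult_right_mono) auto
    finally show ?thesis by (simp add: mult_ac)
  qed
  then have "bounded_linear_between S UNIV (\<lambda>x. L x \<bullet> v)"
    using L unfolding bounded_linear_between_def by (auto simp: inner_add_left)
  then obtain u where u: "u \<in> S" "\<And>x. x \<in> S \<Longrightarrow> x \<bullet> u = L x \<bullet> v"
    using riesz_on_closed_subspace[OF S] by blast
  then have eq: "adjoint_on S L v = u" by (rule adjoint_on_eqI[OF S(1)])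
  show "adjoint_on S L v \<in> S" unfolding eq by (rule u)
  show "x \<bullet> adjoint_on S L v = L x \<bullet> v" if "x \<in> S" for x unfolding eq using that by (rule u)
qed

lemma bounded_linear_between_adjoint_on:
  fixes S :: "'a::{real_inner, complete_space} set"
  assumes S: "subspace S" "closed S" and L: "bounded_linear_between S T L"
  shows "bounded_linear_between T' S (adjoint_on S L)"
  unfolding bounded_linear_between_def
proof (intro conjI ballI allI)
  note adj = adjoint_on_characterization[OF S L]
  show "adjoint_on S L \<in> T' \<rightarrow> S" using adj(1) by blast
  show "adjoint_on S L (v + w) = adjoint_on S L v + adjoint_on S L w" for v w
    by (rule adjoint_on_eqI[OF S(1)]) (use adj S(1) in \<open>auto simp: inner_add_right intro: subspace_add\<close>)
  show "adjoint_on S L (c *\<^sub>R v) = c *\<^sub>R adjoint_on S L v" for c v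
    by (rule adjoint_on_eqI[OF S(1)]) (use adj S(1) in \<open>auto intro: subspace_scale\<close>)
  obtain M where M: "\<And>x. x \<in> S \<Longrightarrow> norm (L x) \<le> M * norm x"
    using L unfolding bounded_linear_between_def by blast
  have "norm (adjoint_on S L v) \<le> \<bar>M\<bar> * norm v" for v
  proof (cases "adjoint_on S L v = 0")
    case False
    have "(norm (adjoint_on S L v))\<^sup>2 = L (adjoint_on S L v) \<bullet> v"
      by (simp add: power2_norm_eq_inner adj)
    also have "\<dots> \<le> norm (L (adjoint_on S L v)) * norm v" by (rule norm_cauchy_schwarz)
    also have "\<dots> \<le> (\<bar>M\<bar> * norm (adjoint_on S L v)) * norm v"
      by (intro mult_right_mono order_trans[OF M[OF adj(1)]]) auto
    finally show ?thesis using False by (simp add: power2_eq_square mult_ac)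
  qed simp
  then show "\<exists>M. \<forall>v\<in>T'. norm (adjoint_on S L v) \<le> M * norm v" by blast
qed

section \<open>Block operators and the skew coupling\<close>

definition matrix_op ::
  "'n::finite set \<Rightarrow> 'm::finite set \<Rightarrow> ('m \<Rightarrow> 'n \<Rightarrow> 'a \<Rightarrow> 'b::comm_monoid_add) \<Rightarrow> 'a ^ 'n \<Rightarrow> 'b ^ 'm" where
  "matrix_op I K L x = (\<chi> k. if k \<in> K then \<Sum>i\<in>I. L k i (x $ i) else 0)"

lemma matrix_op_nth [simp]: "matrix_op I K L x $ k = (if k \<in> K then \<Sum>i\<in>I. L k i (x $ i) else 0)"
  by (simp add: matrix_op_def)

lemma bounded_linear_between_matrix_op:
  fixes I K :: "'n::finite set"
    and H :: "'n \<Rightarrow> 'h::real_inner set" and G :: "'n \<Rightarrow> 'g::real_inner set"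
  assumes G: "\<And>k. k \<in> K \<Longrightarrow> subspace (G k)"
    and L: "\<And>i k. i \<in> I \<Longrightarrow> k \<in> K \<Longrightarrow> bounded_linear_between (H i) (G k) (L k i)"
  shows "bounded_linear_between (family_prod I H) (family_prod K G) (matrix_op I K L)"
  unfolding bounded_linear_between_def
proof (intro conjI ballI allI)
  have nth: "x $ i \<in> H i" if "x \<in> family_prod I H" "i \<in> I" for x i
    using that by (auto simp: family_prod_def)
  show "matrix_op I K L \<in> family_prod I H \<rightarrow> family_prod K G"
    using nth G L by (fastforce simp: family_prod_def bounded_linear_between_def intro!: subspace_sum)
  show "matrix_op I K L (x + y) = matrix_op I K L x + matrix_op I K L y"
    if "x \<in> family_prod I H" "y \<in> family_prod I H" for x y
    using that L nth
    by (auto simp: vec_eq_iff bounded_linear_between_def simp flip: sum.distrib intro!: sum.cong)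
  show "matrix_op I K L (c *\<^sub>R x) = c *\<^sub>R matrix_op I K L x" if "x \<in> family_prod I H" for c x
    using that L nth
    by (auto simp: vec_eq_iff bounded_linear_between_def scaleR_sum_right intro!: sum.cong)
  have ex: "\<exists>M. \<forall>x\<in>H i. norm (L k i x) \<le> M * norm x" if "i \<in> I" "k \<in> K" for k i
    using L[OF that] unfolding bounded_linear_between_def by blast
  define M where "M k i = (SOME M. \<forall>x\<in>H i. norm (L k i x) \<le> M * norm x)" for k i
  have M: "norm (L k i x) \<le> M k i * norm x" if "i \<in> I" "k \<in> K" "x \<in> H i" for k i x
    using someI_ex[OF ex[OF that(1,2)]] that(3) unfolding M_def by blast
  have "norm (matrix_op I K L x) \<le> (\<Sum>k\<in>K. \<Sum>i\<in>I. \<bar>M k i\<bar>) * norm x"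
    if x: "x \<in> family_prod I H" for x
  proof -
    have "norm (matrix_op I K L x) \<le> (\<Sum>k\<in>UNIV. norm (matrix_op I K L x $ k))"
      unfolding norm_vec_def by (rule L2_set_le_sum) simp
    also have "\<dots> = (\<Sum>k\<in>K. norm (\<Sum>i\<in>I. L k i (x $ i)))"
      by (rule sum.mono_neutral_cong_right) auto
    also have "\<dots> \<le> (\<Sum>k\<in>K. \<Sum>i\<in>I. \<bar>M k i\<bar> * norm x)"
    proof (intro sum_mono sum_norm_le)
      fix k i assume ki: "k \<in> K" "i \<in> I"
      have "norm (L k i (x $ i)) \<le> M k i * norm (x $ i)" using ki nth[OF x] by (intro M) auto
      also have "\<dots> \<le> \<bar>M k i\<bar> * norm x"
        by (intro mult_mono) (auto simp: Finite_Cartesian_Product.norm_nth_le)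
      finally show "norm (L k i (x $ i)) \<le> \<bar>M k i\<bar> * norm x" .
    qed
    finally show ?thesis by (simp add: sum_distrib_right)
  qed
  then show "\<exists>M. \<forall>x\<in>family_prod I H. norm (matrix_op I K L x) \<le> M * norm x" by blast
qed

text \<open>
  The adjoint of the block operator has the transposed family of adjoints as its blocks; this
  identifies the sums in the saddle operator with one adjoint between the direct sums.
\<close>

lemma adjoint_on_matrix_op:
  fixes I K :: "'n::finite set"
    and H :: "'n \<Rightarrow> 'h::{real_inner, complete_space} set" and G :: "'n \<Rightarrow> 'g::real_inner set"
  assumes H: "\<And>i. i \<in> I \<Longrightarrow> subspace (H i) \<and> closed (H i)"
    and L: "\<And>i k. i \<in> I \<Longrightarrow> k \<in> K \<Longrightarrow> bounded_linear_between (H i) (G k) (L k i)"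
  shows "adjoint_on (family_prod I H) (matrix_op I K L) v
    = matrix_op K I (\<lambda>i k. adjoint_on (H i) (L k i)) v" (is "_ = ?u")
proof (rule adjoint_on_eqI)
  show "subspace (family_prod I H)" using H by (intro subspace_family_prod) auto
  have adj: "adjoint_on (H i) (L k i) w \<in> H i" "x \<in> H i \<Longrightarrow> x \<bullet> adjoint_on (H i) (L k i) w = L k i x \<bullet> w"
    if "i \<in> I" "k \<in> K" for i k x and w :: 'g
    using H L that adjoint_on_characterization[where S = "H i" and T = "G k" and L = "L k i" and v = w] by auto
  show "?u \<in> family_prod I H"
    using H by (auto simp: family_prod_def intro!: subspace_sum adj)
  fix x assume x: "x \<in> family_prod I H"
  then have "x \<bullet> ?u = (\<Sum>i\<in>I. \<Sum>k\<in>K. x $ i \<bullet> adjoint_on (H i) (L k i) (v $ k))"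
    by (simp add: inner_family_prod inner_sum_right)
  also have "\<dots> = (\<Sum>i\<in>I. \<Sum>k\<in>K. L k i (x $ i) \<bullet> v $ k)"
    using x by (intro sum.cong refl adj) (auto simp: family_prod_def)
  also have "\<dots> = (\<Sum>k\<in>K. (\<Sum>i\<in>I. L k i (x $ i)) \<bullet> v $ k)"
    by (subst sum.swap) (simp add: inner_sum_left)
  also have "\<dots> = matrix_op I K L x \<bullet> v"
    unfolding inner_vec_def by (rule sum.mono_neutral_cong_left) auto
  finally show "x \<bullet> ?u = matrix_op I K L x \<bullet> v" .
qed

text \<open>
  The linear map \<open>(x, y, z, v) \<mapsto> (L\<^sup>* v, - v, - v, y + z - L x)\<close> is skew. Its translates are
  therefore monotone, all the inner products in question being zero, and they are Lipschitzian
  because \<open>L\<close> and its adjoint are bounded.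
\<close>

lemma maximally_monotone_add_affine_skew:
  fixes V :: "'a::{real_inner, complete_space} set" and W :: "'b::{real_inner, complete_space} set"
  assumes V: "subspace V" "closed V" and W: "subspace W" "closed W"
    and L: "bounded_linear_between V W L" and a: "a \<in> V" and b: "b \<in> W"
    and P: "maximally_monotone (V \<times> W \<times> W \<times> W) P"
  shows "maximally_monotone (V \<times> W \<times> W \<times> W)
     (\<lambda>p. P p + {case p of (x, y, z, v) \<Rightarrow> (a + adjoint_on V L v, - v, - v, b + y + z - L x)})"
    (is "maximally_monotone ?X (\<lambda>p. P p + {?J p})")
proof -
  let ?La = "adjoint_on V L"
  note adj = adjoint_on_characterization[OF V L]
  have LW: "L x \<in> W" if "x \<in> V" for x using L that by (auto simp: bounded_linear_between_def)
  have La: "bounded_linear_between W V ?La" by (rule bounded_linear_between_adjoint_on[OF V L])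
  have X: "subspace ?X" "closed ?X" using V W by (auto intro!: subspace_Times closed_Times)
  have J: "?J \<in> ?X \<rightarrow> ?X"
    using a b V W adj(1) LW by (auto intro!: subspace_add subspace_neg subspace_diff)
  have mono: "monotone_op ?X (\<lambda>p. {?J p})"
    unfolding monotone_op_def
  proof (intro ballI)
    fix p q s t assume pq: "p \<in> ?X" "q \<in> ?X" and "s \<in> {?J p}" "t \<in> {?J q}"
    obtain x y z v x' y' z' v' where p: "p = (x, y, z, v)" and q: "q = (x', y', z', v')"
      by (cases p, cases q)
    have xv: "x \<in> V" "x' \<in> V" "v \<in> W" "v' \<in> W" using pq by (auto simp: p q)
    have "(x - x') \<bullet> (?La v - ?La v') = (L x - L x') \<bullet> (v - v')"
      using xv adj(2) by (simp add: inner_diff_left inner_diff_right)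
    then have "(p - q) \<bullet> (?J p - ?J q) = 0"
      unfolding p q by (simp add: algebra_simps inner_commute)
    then show "0 \<le> (p - q) \<bullet> (s - t)" using \<open>s \<in> _\<close> \<open>t \<in> _\<close> by simp
  qed
  obtain l m where l: "l-lipschitz_on V L" and m: "m-lipschitz_on W ?La"
    using bounded_linear_between_lipschitz_on[OF L V(1)] bounded_linear_between_lipschitz_on[OF La W(1)]
    by metis
  have lm: "0 \<le> l" "0 \<le> m" using l m lipschitz_on_nonneg by blast+
  have "(m + 1 + 1 + (1 + 1 + l))-lipschitz_on ?X ?J"
  proof (rule lipschitz_onI)
    fix p q assume pq: "p \<in> ?X" "q \<in> ?X"
    obtain x y z v x' y' z' v' where p: "p = (x, y, z, v)" and q: "q = (x', y', z', v')"
      by (cases p, cases q)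
    define d where "d = norm (p - q)"
    have d: "norm (x - x') \<le> d" "norm (y - y') \<le> d" "norm (z - z') \<le> d" "norm (v - v') \<le> d"
      unfolding d_def p q diff_Pair
      by (meson norm_fst_le norm_snd_le order_trans order_refl)+
    have "norm (L x - L x') \<le> l * d"
      using lipschitz_on_normD[OF l, of x x'] pq d(1) lm mult_left_mono[OF d(1) lm(1)] by (auto simp: p q)
    moreover have "norm (?La v - ?La v') \<le> m * d"
      using lipschitz_on_normD[OF m, of v v'] pq mult_left_mono[OF d(4) lm(2)] by (auto simp: p q)
    moreover have "norm ((y - y') + (z - z') - (L x - L x')) \<le> norm (y - y') + norm (z - z') + norm (L x - L x')"
      by (smt (verit) norm_triangle_ineq norm_triangle_ineq4)
    moreover have "?J p - ?J q = (?La v - ?La v', - (v - v'), - (v - v'), (y - y') + (z - z') - (L x - L x'))"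
      by (simp add: p q algebra_simps)
    moreover have "norm (e, f, g, h) \<le> norm e + norm f + norm g + norm h" for e :: 'a and f g h :: 'b
      using norm_Pair_le[of e "(f, g, h)"] norm_Pair_le[of f "(g, h)"] norm_Pair_le[of g h] by linarith
    ultimately have "norm (?J p - ?J q) \<le> m * d + d + d + (d + d + l * d)"
      using d by (smt (verit) norm_minus_cancel)
    then show "dist (?J p) (?J q) \<le> (m + 1 + 1 + (1 + 1 + l)) * dist p q"
      by (simp add: dist_norm d_def algebra_simps)
  qed (use lm in simp)
  then show ?thesis
    by (rule maximally_monotone_add_lipschitz[OF X P J mono])
qed

text \<open>
  The saddle operator is a product of maximally monotone operators perturbed by the affine skew
  coupling. The last factor of the product is the constant operator \<open>{0}\<close>, since the last
  coordinate of the saddle operator is purely affine.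
\<close>

lemma maximally_monotone_saddle_op:
  fixes I K :: "'n::finite set"
    and H :: "'n \<Rightarrow> 'h::{real_inner, complete_space} set"
    and G :: "'n \<Rightarrow> 'g::{real_inner, complete_space} set"
  assumes H: "\<And>i. i \<in> I \<Longrightarrow> subspace (H i) \<and> closed (H i)"
    and G: "\<And>k. k \<in> K \<Longrightarrow> subspace (G k) \<and> closed (G k)"
    and s: "\<And>i. i \<in> I \<Longrightarrow> s i \<in> H i"
    and r: "\<And>k. k \<in> K \<Longrightarrow> r k \<in> G k"
    and L: "\<And>i k. i \<in> I \<Longrightarrow> k \<in> K \<Longrightarrow> bounded_linear_between (H i) (G k) (L k i)"
    and M: "maximally_monotone (family_prod I H) (\<lambda>x. family_prod I (\<lambda>i. M i x))"
    and B: "\<And>k. k \<in> K \<Longrightarrow> maximally_monotone (G k) (B k)"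
    and D: "\<And>k. k \<in> K \<Longrightarrow> maximally_monotone (G k) (D k)"
  shows "maximally_monotone (family_prod I H \<times> family_prod K G \<times> family_prod K G \<times> family_prod K G)
           (saddle_op I K H s r L M B D)"
proof -
  let ?V = "family_prod I H" and ?W = "family_prod K G"
  have V: "subspace ?V" "closed ?V"
    using H by (auto intro!: subspace_family_prod closed_family_prod)
  have W: "subspace ?W" "closed ?W"
    using G by (auto intro!: subspace_family_prod closed_family_prod)
  define P where "P = (\<lambda>(x, y, z, v :: 'g ^ 'n). family_prod I (\<lambda>i. M i x) \<times>
      family_prod K (\<lambda>k. B k (y $ k)) \<times> family_prod K (\<lambda>k. D k (z $ k)) \<times> {0 :: 'g ^ 'n})"
  have "maximally_monotone (?V \<times> ?W \<times> ?W \<times> ?W) P"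
    using maximally_monotone_Times[OF M maximally_monotone_Times[OF
        maximally_monotone_family_prod[of K G B] maximally_monotone_Times[OF
        maximally_monotone_family_prod[of K G D] maximally_monotone_const_0[OF W(1)]]]] G B D
    by (auto simp: P_def case_prod_unfold)
  moreover define a where "a = (\<chi> i. if i \<in> I then - s i else 0)"
  moreover define b where "b = (\<chi> k. if k \<in> K then r k else 0)"
  moreover have "a \<in> ?V" using H s by (auto simp: a_def family_prod_def intro!: subspace_neg)
  moreover have "b \<in> ?W" using r by (auto simp: b_def family_prod_def)
  moreover have "bounded_linear_between ?V ?W (matrix_op I K L)"
    using G L by (intro bounded_linear_between_matrix_op) auto
  ultimately have max: "maximally_monotone (?V \<times> ?W \<times> ?W \<times> ?W)
     (\<lambda>p. P p + {case p of (x, y, z, v) \<Rightarrow>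
        (a + adjoint_on ?V (matrix_op I K L) v, - v, - v, b + y + z - matrix_op I K L x)})"
    using V W by (intro maximally_monotone_add_affine_skew) auto
  have "saddle_op I K H s r L M B D p = P p + {case p of (x, y, z, v) \<Rightarrow>
        (a + adjoint_on ?V (matrix_op I K L) v, - v, - v, b + y + z - matrix_op I K L x)}"
    if p: "p \<in> ?V \<times> ?W \<times> ?W \<times> ?W" for p
  proof -
    obtain x y z v where p_eq: "p = (x, y, z, v)" by (cases p)
    have 0: "v $ k = 0" "y $ k = 0" "z $ k = 0" if "k \<notin> K" for k
      using p that by (auto simp: p_eq family_prod_def)
    have adj: "adjoint_on ?V (matrix_op I K L) v = matrix_op K I (\<lambda>i k. adjoint_on (H i) (L k i)) v"
      using H L by (rule adjoint_on_matrix_op)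
    have "q \<in> saddle_op I K H s r L M B D p \<longleftrightarrow> q \<in> P p + {case p of (x, y, z, v) \<Rightarrow>
        (a + adjoint_on ?V (matrix_op I K L) v, - v, - v, b + y + z - matrix_op I K L x)}" for q
    proof (cases q)
      case (fields x' y' z' v')
      have "u \<in> {- s i} + M i x + {c} \<longleftrightarrow> u - (- s i + c) \<in> M i x" for u c i
        unfolding mem_singleton_plus_plus_singleton_iff by (simp add: algebra_simps)
      then have x': "x' \<in> family_prod I (\<lambda>i. {- s i} + M i x + {\<Sum>k\<in>K. adjoint_on (H i) (L k i) (v $ k)}) \<longleftrightarrow>
          x' - (a + matrix_op K I (\<lambda>i k. adjoint_on (H i) (L k i)) v) \<in> family_prod I (\<lambda>i. M i x)"
        by (simp add: family_prod_def a_def)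
      have yz': "u \<in> family_prod K (\<lambda>k. F k + {- (v $ k)}) \<longleftrightarrow> u - (- v) \<in> family_prod K F"
        for u and F :: "'n \<Rightarrow> 'g set"
        using 0(1) by (simp add: family_prod_def mem_plus_singleton_iff)
      have "b + y + z - matrix_op I K L x
          = (\<chi> k. if k \<in> K then r k + y $ k + z $ k - (\<Sum>i\<in>I. L k i (x $ i)) else 0)"
        using 0 by (simp add: b_def vec_eq_iff)
      then have v': "v' \<in> family_prod K (\<lambda>k. {r k + y $ k + z $ k - (\<Sum>i\<in>I. L k i (x $ i))}) \<longleftrightarrow>
          v' - (b + y + z - matrix_op I K L x) \<in> {0}"
        unfolding mem_family_prod_singleton_iff singleton_iff right_minus_eq by (rule arg_cong[OF sym])
      show ?thesis
        unfolding fields p_eq mem_plus_singleton_iff saddle_op_def P_def prod.case adj diff_Pair mem_Times_iff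
          fst_conv snd_conv x' v' yz'[of y' "\<lambda>k. B k (y $ k)"] yz'[of z' "\<lambda>k. D k (z $ k)"] ..
    qed
    then show ?thesis by blast
  qed
  from iffD2[OF maximally_monotone_cong[OF this] max] show ?thesis .
qed

section \<open>Kuhn--Tucker points, primal and dual solutions\<close>

lemma mem_parallel_sum_iff:
  "v \<in> parallel_sum S B D x \<longleftrightarrow> v \<in> S \<and> (\<exists>y\<in>S. \<exists>z\<in>S. x = y + z \<and> v \<in> B y \<and> v \<in> D z)"
  by (auto simp: parallel_sum_def inverse_op_def elim!: set_plus_elim)

text \<open>
  Membership of \<open>v $ k\<close> in the parallel sum is the same as the inclusion with the inverses once
  \<open>v $ k \<in> G k\<close> is known. In this form the conditions are those of the dual problem, with the
  vector \<open>x\<close> recorded instead of existentially quantified.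
\<close>

lemma kuhn_tucker_set_iff:
  "(x, v) \<in> kuhn_tucker_set I K H G s r L M B D \<longleftrightarrow>
     x \<in> family_prod I H \<and> v \<in> family_prod K G \<and>
     (\<forall>i\<in>I. s i - (\<Sum>j\<in>K. adjoint_on (H i) (L j i) (v $ j)) \<in> M i x) \<and>
     (\<forall>k\<in>K. v $ k \<in> parallel_sum (G k) (B k) (D k) ((\<Sum>j\<in>I. L k j (x $ j)) - r k))"
proof -
  have "v $ k \<in> G k" if "v \<in> family_prod K G" "k \<in> K" for k
    using that by (auto simp: family_prod_def)
  then show ?thesis
    by (auto simp: kuhn_tucker_set_def parallel_sum_def inverse_op_def)
qed

lemma mem_zer_saddle_op_iff:
  "(x, y, z, v) \<in> zer (family_prod I H \<times> family_prod K G \<times> family_prod K G \<times> family_prod K G)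
        (saddle_op I K H s r L M B D) \<longleftrightarrow>
     x \<in> family_prod I H \<and> y \<in> family_prod K G \<and> z \<in> family_prod K G \<and> v \<in> family_prod K G \<and>
     (\<forall>i\<in>I. s i - (\<Sum>j\<in>K. adjoint_on (H i) (L j i) (v $ j)) \<in> M i x) \<and>
     (\<forall>k\<in>K. v $ k \<in> B k (y $ k) \<and> v $ k \<in> D k (z $ k) \<and>
        (\<Sum>j\<in>I. L k j (x $ j)) - r k = y $ k + z $ k)"
proof -
  have "0 \<in> {- a} + M i x + {b} \<longleftrightarrow> a - b \<in> M i x" for a b i
    by (simp add: mem_singleton_plus_plus_singleton_iff)
  moreover have "0 = r k + y $ k + z $ k - b \<longleftrightarrow> b - r k = y $ k + z $ k" for k b
    by (auto simp: algebra_simps)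
  ultimately show ?thesis
    unfolding zer_def saddle_op_def zero_prod_def
    by (simp add: mem_plus_singleton_iff zero_mem_family_prod_iff) blast
qed

text \<open>
  The Kuhn--Tucker set is the projection of the zeros of the saddle operator: \<open>y $ k\<close> and \<open>z $ k\<close>
  are the two summands that witness membership in the parallel sum.
\<close>

lemma kuhn_tucker_set_iff_zer_saddle_op:
  "(x, v) \<in> kuhn_tucker_set I K H G s r L M B D \<longleftrightarrow>
     (\<exists>y z. (x, y, z, v) \<in> zer (family_prod I H \<times> family_prod K G \<times> family_prod K G \<times> family_prod K G)
        (saddle_op I K H s r L M B D))" (is "?Z \<longleftrightarrow> (\<exists>y z. ?zer y z)")
proof
  assume Z: ?Z
  then have "\<forall>k\<in>K. \<exists>p. fst p \<in> G k \<and> snd p \<in> G k \<and>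
      (\<Sum>j\<in>I. L k j (x $ j)) - r k = fst p + snd p \<and> v $ k \<in> B k (fst p) \<and> v $ k \<in> D k (snd p)"
    by (simp add: kuhn_tucker_set_iff mem_parallel_sum_iff Bex_def)
  from bchoice[OF this] obtain p where p: "\<forall>k\<in>K. fst (p k) \<in> G k \<and> snd (p k) \<in> G k \<and>
      (\<Sum>j\<in>I. L k j (x $ j)) - r k = fst (p k) + snd (p k) \<and>
      v $ k \<in> B k (fst (p k)) \<and> v $ k \<in> D k (snd (p k))" ..
  have "?zer (\<chi> k. if k \<in> K then fst (p k) else 0) (\<chi> k. if k \<in> K then snd (p k) else 0)"
    unfolding mem_zer_saddle_op_iff
    using Z p by (simp add: kuhn_tucker_set_iff family_prod_def)
  then show "\<exists>y z. ?zer y z" by blast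
next
  assume "\<exists>y z. ?zer y z"
  then obtain y z where zer: "?zer y z" by blast
  have "v $ k \<in> G k \<and> y $ k \<in> G k \<and> z $ k \<in> G k" if "k \<in> K" for k
    using zer that unfolding mem_zer_saddle_op_iff by (simp add: family_prod_def)
  then have "v $ k \<in> parallel_sum (G k) (B k) (D k) ((\<Sum>j\<in>I. L k j (x $ j)) - r k)" if "k \<in> K" for k
    unfolding mem_parallel_sum_iff using zer that unfolding mem_zer_saddle_op_iff
    by (intro conjI bexI[of _ "y $ k"] bexI[of _ "z $ k"]) simp_all
  with zer show ?Z
    unfolding mem_zer_saddle_op_iff kuhn_tucker_set_iff by simp
qed

lemma dual_solutions_iff_kuhn_tucker_set:
  assumes "T = (\<lambda>k. parallel_sum (G k) (B k) (D k))"
  shows "v \<in> dual_solutions I K H G s r L M T \<longleftrightarrow> (\<exists>x. (x, v) \<in> kuhn_tucker_set I K H G s r L M B D)"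
  unfolding kuhn_tucker_set_iff dual_solutions_def assms by blast

text \<open>
  The Minkowski sum in the primal inclusion hides a choice of dual vectors, and this choice may
  depend on \<open>i\<close>. That dependence is the gap between primal solutions and Kuhn--Tucker points.
\<close>

lemma primal_solutions_iff:
  "x \<in> primal_solutions I K H s r L M T \<longleftrightarrow>
     x \<in> family_prod I H \<and>
     (\<forall>i\<in>I. \<exists>w. (\<forall>k\<in>K. w k \<in> T k ((\<Sum>j\<in>I. L k j (x $ j)) - r k)) \<and>
        s i - (\<Sum>k\<in>K. adjoint_on (H i) (L k i) (w k)) \<in> M i x)"
proof -
  have "s i \<in> M i x + (\<Sum>k\<in>K. adjoint_on (H i) (L k i) ` T k (c k)) \<longleftrightarrow>
     (\<exists>w. (\<forall>k\<in>K. w k \<in> T k (c k)) \<and> s i - (\<Sum>k\<in>K. adjoint_on (H i) (L k i) (w k)) \<in> M i x)"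
    (is "?l \<longleftrightarrow> ?r") for i c
  proof
    assume ?l
    then obtain m e where m: "m \<in> M i x" "s i = m + sum e K"
      and e: "\<forall>k\<in>K. e k \<in> adjoint_on (H i) (L k i) ` T k (c k)"
      unfolding set_sum_alt[OF finite[of K]] by (auto elim!: set_plus_elim)
    from e have "\<forall>k\<in>K. \<exists>w. w \<in> T k (c k) \<and> e k = adjoint_on (H i) (L k i) w" by blast
    then obtain w where "\<forall>k\<in>K. w k \<in> T k (c k) \<and> e k = adjoint_on (H i) (L k i) (w k)" by metis
    with m show ?r by (intro exI[of _ w]) (simp cong: sum.cong)
  next
    assume ?r
    then obtain w where w: "\<forall>k\<in>K. w k \<in> T k (c k)"
      and m: "s i - (\<Sum>k\<in>K. adjoint_on (H i) (L k i) (w k)) \<in> M i x" by blast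
    have "(\<Sum>k\<in>K. adjoint_on (H i) (L k i) (w k)) \<in> (\<Sum>k\<in>K. adjoint_on (H i) (L k i) ` T k (c k))"
      unfolding set_sum_alt[OF finite[of K]] using w by blast
    from set_plus_intro[OF m this] show ?l by simp
  qed
  then show ?thesis by (simp add: primal_solutions_def)
qed

lemma kuhn_tucker_set_subset:
  assumes "T = (\<lambda>k. parallel_sum (G k) (B k) (D k))"
  shows "kuhn_tucker_set I K H G s r L M B D
     \<subseteq> primal_solutions I K H s r L M T \<times> dual_solutions I K H G s r L M T"
proof (rule subsetI, clarify, intro conjI)
  fix x v assume Z: "(x, v) \<in> kuhn_tucker_set I K H G s r L M B D"
  then show "v \<in> dual_solutions I K H G s r L M T"
    using dual_solutions_iff_kuhn_tucker_set[OF assms] by blast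
  show "x \<in> primal_solutions I K H s r L M T"
    using Z unfolding primal_solutions_iff kuhn_tucker_set_iff assms
    by (intro conjI ballI exI[of _ "\<lambda>k. v $ k"]) simp_all
qed

text \<open>
  A primal solution comes with dual vectors \<open>W i k\<close> depending on \<open>i\<close>. It extends to a
  Kuhn--Tucker point as soon as they can be replaced by \<open>w k\<close>, with no dependence on \<open>i\<close>, that have the
  same image under the adjoints.
\<close>

lemma kuhn_tucker_set_nonemptyI:
  assumes x: "x \<in> primal_solutions I K H s r L M T"
    and T: "T = (\<lambda>k. parallel_sum (G k) (B k) (D k))"
    and glue: "\<And>W. (\<And>i k. i \<in> I \<Longrightarrow> k \<in> K \<Longrightarrow> W i k \<in> T k ((\<Sum>j\<in>I. L k j (x $ j)) - r k)) \<Longrightarrow>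
      \<exists>w. \<forall>k\<in>K. w k \<in> T k ((\<Sum>j\<in>I. L k j (x $ j)) - r k) \<and>
        (\<forall>i\<in>I. adjoint_on (H i) (L k i) (W i k) = adjoint_on (H i) (L k i) (w k))"
  shows "kuhn_tucker_set I K H G s r L M B D \<noteq> {}"
proof -
  obtain W where W: "\<And>i k. i \<in> I \<Longrightarrow> k \<in> K \<Longrightarrow> W i k \<in> T k ((\<Sum>j\<in>I. L k j (x $ j)) - r k)"
    and M: "\<And>i. i \<in> I \<Longrightarrow> s i - (\<Sum>k\<in>K. adjoint_on (H i) (L k i) (W i k)) \<in> M i x"
  proof -
    have "\<forall>i\<in>I. \<exists>w. (\<forall>k\<in>K. w k \<in> T k ((\<Sum>j\<in>I. L k j (x $ j)) - r k)) \<and>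
        s i - (\<Sum>k\<in>K. adjoint_on (H i) (L k i) (w k)) \<in> M i x"
      using x unfolding primal_solutions_iff by (rule conjunct2)
    from bchoice[OF this] show thesis using that by blast
  qed
  have "\<exists>w. \<forall>k\<in>K. w k \<in> T k ((\<Sum>j\<in>I. L k j (x $ j)) - r k) \<and>
        (\<forall>i\<in>I. adjoint_on (H i) (L k i) (W i k) = adjoint_on (H i) (L k i) (w k))"
    by (rule glue[OF W])
  then obtain w where w: "\<And>k. k \<in> K \<Longrightarrow> w k \<in> T k ((\<Sum>j\<in>I. L k j (x $ j)) - r k)"
    and eq: "\<And>i k. i \<in> I \<Longrightarrow> k \<in> K \<Longrightarrow> adjoint_on (H i) (L k i) (W i k) = adjoint_on (H i) (L k i) (w k)"
    by blast
  have "(x, \<chi> k. if k \<in> K then w k else 0) \<in> kuhn_tucker_set I K H G s r L M B D"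
    unfolding kuhn_tucker_set_iff
  proof (intro conjI ballI)
    show "x \<in> family_prod I H" using x by (simp add: primal_solutions_iff)
    show "(\<chi> k. if k \<in> K then w k else 0) \<in> family_prod K G"
      using w by (auto simp: family_prod_def T mem_parallel_sum_iff)
    show "s i - (\<Sum>j\<in>K. adjoint_on (H i) (L j i) ((\<chi> k. if k \<in> K then w k else 0) $ j)) \<in> M i x"
      if "i \<in> I" for i
      using M[OF that] eq[OF that] by simp
  qed (use w in \<open>simp add: T\<close>)
  then show ?thesis by blast
qed

text \<open>
  Two values \<open>u\<close> and \<open>v\<close> at one point split it as \<open>y + z = y' + z'\<close>. The increments
  \<open>y - y'\<close> and \<open>z - z'\<close> are opposite, while monotonicity of \<open>B\<close> and strict monotonicity of
  the inverse of \<open>D\<close> give their inner products with \<open>u - v\<close> incompatible signs.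
\<close>

lemma at_most_single_valued_parallel_sum:
  assumes B: "monotone_op S B" and D: "strictly_monotone_op S (inverse_op S D)"
  shows "at_most_single_valued S (parallel_sum S B D)"
  unfolding at_most_single_valued_def mem_parallel_sum_iff
proof (intro ballI)
  fix x u v
  assume "u \<in> parallel_sum S B D x" "v \<in> parallel_sum S B D x"
  then obtain y z y' z' where uv: "u \<in> S" "v \<in> S" and S: "y \<in> S" "y' \<in> S" "z \<in> S" "z' \<in> S"
    and sum: "x = y + z" "x = y' + z'" and BD: "u \<in> B y" "u \<in> D z" "v \<in> B y'" "v \<in> D z'"
    unfolding mem_parallel_sum_iff by blast
  show "u = v"
  proof (rule ccontr)
    assume "u \<noteq> v"
    moreover have "z \<in> inverse_op S D u" "z' \<in> inverse_op S D v"
      using S BD by (auto simp: inverse_op_def)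
    ultimately have "0 < (u - v) \<bullet> (z - z')"
      using D uv unfolding strictly_monotone_op_def by blast
    moreover have "0 \<le> (y - y') \<bullet> (u - v)"
      using B S BD unfolding monotone_op_def by blast
    moreover have "y - y' = - (z - z')" using sum by (simp add: algebra_simps)
    then have "(y - y') \<bullet> (u - v) = - ((u - v) \<bullet> (z - z'))" by (simp only: inner_minus_left inner_minus_right inner_commute)
    ultimately show False by linarith
  qed
qed

text \<open>
  Under each coupling hypothesis the dual vectors can be chosen independently of \<open>i\<close>: there is
  only one index; or the parallel sums leave no choice (which includes the strictly monotone
  case); or, for \<open>k \<in> I\<close>, the only block \<open>L k i\<close> that can be nonzero is the diagonal one, so that the
  choice made for the index \<open>k\<close> itself can be used.
\<close>

lemma kuhn_tucker_set_nonempty_of_primal: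
  fixes H :: "'n::finite \<Rightarrow> 'h::{real_inner, complete_space} set" and G :: "'n \<Rightarrow> 'g::real_inner set"
  assumes I: "I \<noteq> {}" and H: "\<And>i. i \<in> I \<Longrightarrow> subspace (H i) \<and> closed (H i)"
    and G: "\<And>k. k \<in> K \<Longrightarrow> subspace (G k)"
    and L: "\<And>i k. i \<in> I \<Longrightarrow> k \<in> K \<Longrightarrow> bounded_linear_between (H i) (G k) (L k i)"
    and r: "\<And>k. k \<in> K \<Longrightarrow> r k \<in> G k"
    and B: "\<And>k. k \<in> K \<Longrightarrow> monotone_op (G k) (B k)"
    and T: "T = (\<lambda>k. parallel_sum (G k) (B k) (D k))"
    and coupling: "is_singleton I
         \<or> (\<forall>k\<in>K. at_most_single_valued (G k) (T k))
         \<or> (\<forall>k\<in>K. strictly_monotone_op (G k) (inverse_op (G k) (D k)))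
         \<or> (I \<subseteq> K \<and> (\<forall>k\<in>K - I. at_most_single_valued (G k) (T k)) \<and>
            (\<forall>i\<in>I. \<forall>k\<in>I. k \<noteq> i \<longrightarrow> (\<forall>x\<in>H i. L k i x = 0)))"
    and primal: "primal_solutions I K H s r L M T \<noteq> {}"
  shows "kuhn_tucker_set I K H G s r L M B D \<noteq> {}"
proof -
  obtain x where x: "x \<in> primal_solutions I K H s r L M T" using primal by blast
  let ?q = "\<lambda>k. (\<Sum>j\<in>I. L k j (x $ j)) - r k"
  have q: "?q k \<in> G k" if "k \<in> K" for k
  proof (intro subspace_diff subspace_sum G r that)
    fix j assume "j \<in> I"
    then show "L k j (x $ j) \<in> G k"
      using x L[of j k] that by (auto simp: primal_solutions_iff family_prod_def bounded_linear_between_def)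
  qed
  obtain i0 where i0: "i0 \<in> I" using I by blast
  consider (singleton) "I = {i0}"
    | (single_valued) "\<forall>k\<in>K. at_most_single_valued (G k) (T k)"
    | (block) "I \<subseteq> K" "\<forall>k\<in>K - I. at_most_single_valued (G k) (T k)"
        "\<forall>i\<in>I. \<forall>k\<in>I. k \<noteq> i \<longrightarrow> (\<forall>x\<in>H i. L k i x = 0)"
    using coupling i0 at_most_single_valued_parallel_sum[OF B] unfolding T
    by (auto simp: is_singleton_def)
  then show ?thesis
  proof (cases)
    case singleton
    show ?thesis
    proof (rule kuhn_tucker_set_nonemptyI[OF x T])
      fix W assume "\<And>i k. i \<in> I \<Longrightarrow> k \<in> K \<Longrightarrow> W i k \<in> T k (?q k)"
      then show "\<exists>w. \<forall>k\<in>K. w k \<in> T k (?q k) \<and>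
          (\<forall>i\<in>I. adjoint_on (H i) (L k i) (W i k) = adjoint_on (H i) (L k i) (w k))"
        by (intro exI[of _ "W i0"]) (auto simp: singleton)
    qed
  next
    case single_valued
    show ?thesis
    proof (rule kuhn_tucker_set_nonemptyI[OF x T])
      fix W assume W: "\<And>i k. i \<in> I \<Longrightarrow> k \<in> K \<Longrightarrow> W i k \<in> T k (?q k)"
      have "W i k = W i0 k" if "i \<in> I" "k \<in> K" for i k
        using single_valued W[OF that] W[OF i0 that(2)] q that unfolding at_most_single_valued_def by blast
      then show "\<exists>w. \<forall>k\<in>K. w k \<in> T k (?q k) \<and>
          (\<forall>i\<in>I. adjoint_on (H i) (L k i) (W i k) = adjoint_on (H i) (L k i) (w k))"
        using W[OF i0] by (intro exI[of _ "W i0"]) auto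
    qed
  next
    case block
    show ?thesis
    proof (rule kuhn_tucker_set_nonemptyI[OF x T])
      fix W assume W: "\<And>i k. i \<in> I \<Longrightarrow> k \<in> K \<Longrightarrow> W i k \<in> T k (?q k)"
      have outside: "W i k = W i0 k" if "i \<in> I" "k \<in> K" "k \<notin> I" for i k
        using block(2) W[OF that(1,2)] W[OF i0 that(2)] q that unfolding at_most_single_valued_def by blast
      have zero: "adjoint_on (H i) (L k i) u = 0" if "i \<in> I" "k \<in> I" "k \<noteq> i" for i k u
        using that block(3) H by (intro adjoint_on_eqI) (auto simp: subspace_0)
      have "adjoint_on (H i) (L k i) (W i k) = adjoint_on (H i) (L k i) (if k \<in> I then W k k else W i0 k)"
        if "i \<in> I" "k \<in> K" for i k
        using that zero[of i k] outside[of i k] by (cases "k = i") auto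
      then show "\<exists>w. \<forall>k\<in>K. w k \<in> T k (?q k) \<and>
          (\<forall>i\<in>I. adjoint_on (H i) (L k i) (W i k) = adjoint_on (H i) (L k i) (w k))"
        using W i0 by (intro exI[of _ "\<lambda>k. if k \<in> I then W k k else W i0 k"]) simp
    qed
  qed
qed

section \<open>Properties of the saddle operator\<close>

theorem proposition2p2:
  fixes I K :: "'n::finite set"
    and H :: "'n \<Rightarrow> 'h::{real_inner, complete_space} set"
    and G :: "'n \<Rightarrow> 'g::{real_inner, complete_space} set"
    and s :: "'n \<Rightarrow> 'h" and r :: "'n \<Rightarrow> 'g"
    and A :: "'n \<Rightarrow> 'h \<Rightarrow> 'h set" and C Q :: "'n \<Rightarrow> 'h \<Rightarrow> 'h" and R :: "'n \<Rightarrow> 'h ^ 'n \<Rightarrow> 'h"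
    and Bm Dm :: "'n \<Rightarrow> 'g \<Rightarrow> 'g set" and Bc Bl Dc Dl :: "'n \<Rightarrow> 'g \<Rightarrow> 'g"
    and L :: "'n \<Rightarrow> 'n \<Rightarrow> 'h \<Rightarrow> 'g"
    and alphac alphal betac betal deltac deltal :: "'n \<Rightarrow> real" and chi :: real
  assumes I_nonempty: "I \<noteq> {}"
    and H: "\<And>i. i \<in> I \<Longrightarrow> subspace (H i) \<and> closed (H i)"
    and G: "\<And>k. k \<in> K \<Longrightarrow> subspace (G k) \<and> closed (G k)"
    and s: "\<And>i. i \<in> I \<Longrightarrow> s i \<in> H i"
    and r: "\<And>k. k \<in> K \<Longrightarrow> r k \<in> G k"
    and A: "\<And>i. i \<in> I \<Longrightarrow> maximally_monotone (H i) (A i)"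
    and C: "\<And>i. i \<in> I \<Longrightarrow> C i \<in> H i \<rightarrow> H i \<and> 0 < alphac i \<and> cocoercive (H i) (alphac i) (C i)"
    and Q: "\<And>i. i \<in> I \<Longrightarrow> Q i \<in> H i \<rightarrow> H i \<and> monotone_op (H i) (\<lambda>x. {Q i x}) \<and>
              (alphal i)-lipschitz_on (H i) (Q i)"
    and R_maps: "\<And>i. i \<in> I \<Longrightarrow> R i \<in> family_prod I H \<rightarrow> H i"
    and Bm: "\<And>k. k \<in> K \<Longrightarrow> maximally_monotone (G k) (Bm k)"
    and Bc: "\<And>k. k \<in> K \<Longrightarrow> Bc k \<in> G k \<rightarrow> G k \<and> 0 < betac k \<and> cocoercive (G k) (betac k) (Bc k)"
    and Bl: "\<And>k. k \<in> K \<Longrightarrow> Bl k \<in> G k \<rightarrow> G k \<and> monotone_op (G k) (\<lambda>y. {Bl k y}) \<and>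
              (betal k)-lipschitz_on (G k) (Bl k)"
    and Dm: "\<And>k. k \<in> K \<Longrightarrow> maximally_monotone (G k) (Dm k)"
    and Dc: "\<And>k. k \<in> K \<Longrightarrow> Dc k \<in> G k \<rightarrow> G k \<and> 0 < deltac k \<and> cocoercive (G k) (deltac k) (Dc k)"
    and Dl: "\<And>k. k \<in> K \<Longrightarrow> Dl k \<in> G k \<rightarrow> G k \<and> monotone_op (G k) (\<lambda>y. {Dl k y}) \<and>
              (deltal k)-lipschitz_on (G k) (Dl k)"
    and L: "\<And>i k. i \<in> I \<Longrightarrow> k \<in> K \<Longrightarrow> bounded_linear_between (H i) (G k) (L k i)"
    and R_mono: "monotone_op (family_prod I H) (\<lambda>x. {\<chi> i. if i \<in> I then R i x else 0})"
    and R_lip: "chi-lipschitz_on (family_prod I H) (\<lambda>x. \<chi> i. if i \<in> I then R i x else 0)"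
  shows
    "let M = (\<lambda>i x. A i (x $ i) + {C i (x $ i)} + {Q i (x $ i)} + {R i x});
         B = (\<lambda>k y. Bm k y + {Bc k y} + {Bl k y});
         D = (\<lambda>k z. Dm k z + {Dc k z} + {Dl k z});
         T = (\<lambda>k. parallel_sum (G k) (B k) (D k));
         X = family_prod I H \<times> family_prod K G \<times> family_prod K G \<times> family_prod K G;
         S = saddle_op I K H s r L M B D;
         PP = primal_solutions I K H s r L M T;
         DD = dual_solutions I K H G s r L M T;
         Z = kuhn_tucker_set I K H G s r L M B D
     in
       maximally_monotone X S \<and>
       (closed (zer X S) \<and> convex (zer X S)) \<and>
       ((\<forall>x y z v. (x, y, z, v) \<in> zer X S \<longrightarrow> (x, v) \<in> Z) \<and> Z \<subseteq> PP \<times> DD) \<and>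
       ((DD \<noteq> {} \<longleftrightarrow> zer X S \<noteq> {}) \<and> (zer X S \<noteq> {} \<longleftrightarrow> Z \<noteq> {}) \<and> (Z \<noteq> {} \<longrightarrow> PP \<noteq> {})) \<and>
       ((is_singleton I
         \<or> (\<forall>k\<in>K. at_most_single_valued (G k) (T k))
         \<or> (\<forall>k\<in>K. strictly_monotone_op (G k) (inverse_op (G k) (D k)))
         \<or> (I \<subseteq> K \<and> (\<forall>k\<in>K - I. at_most_single_valued (G k) (T k)) \<and>
            (\<forall>i\<in>I. \<forall>k\<in>I. k \<noteq> i \<longrightarrow> (\<forall>x\<in>H i. L k i x = 0))))
        \<longrightarrow> PP \<noteq> {} \<longrightarrow> Z \<noteq> {})"
proof -
  let ?M = "\<lambda>i x. A i (x $ i) + {C i (x $ i)} + {Q i (x $ i)} + {R i x}"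
  let ?B = "\<lambda>k y. Bm k y + {Bc k y} + {Bl k y}"
  let ?D = "\<lambda>k z. Dm k z + {Dc k z} + {Dl k z}"
  let ?T = "\<lambda>k. parallel_sum (G k) (?B k) (?D k)"
  let ?X = "family_prod I H \<times> family_prod K G \<times> family_prod K G \<times> family_prod K G"
  let ?S = "saddle_op I K H s r L ?M ?B ?D"
  let ?PP = "primal_solutions I K H s r L ?M ?T"
  let ?DD = "dual_solutions I K H G s r L ?M ?T"
  let ?Z = "kuhn_tucker_set I K H G s r L ?M ?B ?D"
  have ACQ: "maximally_monotone (H i) (\<lambda>x. A i x + {C i x} + {Q i x})" if "i \<in> I" for i
    by (rule maximally_monotone_add_cocoercive_add_lipschitz[OF H[OF that] A[OF that] C[OF that] Q[OF that]])
  have M: "maximally_monotone (family_prod I H) (\<lambda>x. family_prod I (\<lambda>i. ?M i x))"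
    by (rule maximally_monotone_coupled_family_prod[OF H ACQ R_maps R_mono R_lip])
  have B: "maximally_monotone (G k) (?B k)" if "k \<in> K" for k
    by (rule maximally_monotone_add_cocoercive_add_lipschitz[OF G[OF that] Bm[OF that] Bc[OF that] Bl[OF that]])
  have D: "maximally_monotone (G k) (?D k)" if "k \<in> K" for k
    by (rule maximally_monotone_add_cocoercive_add_lipschitz[OF G[OF that] Dm[OF that] Dc[OF that] Dl[OF that]])
  have X: "subspace ?X" "closed ?X"
    using H G by (auto intro!: subspace_Times closed_Times subspace_family_prod closed_family_prod)
  have maximal: "maximally_monotone ?X ?S"
    by (rule maximally_monotone_saddle_op[OF H G s r L M B D])
  have zer: "closed (zer ?X ?S) \<and> convex (zer ?X ?S)"
    by (rule closed_convex_zer[OF X maximal])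
  have Z_iff: "(x, v) \<in> ?Z \<longleftrightarrow> (\<exists>y z. (x, y, z, v) \<in> zer ?X ?S)" for x v
    by (rule kuhn_tucker_set_iff_zer_saddle_op)
  have zer_Z: "\<forall>x y z v. (x, y, z, v) \<in> zer ?X ?S \<longrightarrow> (x, v) \<in> ?Z"
    using Z_iff by blast
  have Z_subset: "?Z \<subseteq> ?PP \<times> ?DD"
    by (rule kuhn_tucker_set_subset[OF refl])
  have zer_nonempty: "zer ?X ?S \<noteq> {} \<longleftrightarrow> ?Z \<noteq> {}"
    unfolding ex_in_conv[symmetric] split_paired_Ex Z_iff by blast
  have dual_nonempty: "?DD \<noteq> {} \<longleftrightarrow> zer ?X ?S \<noteq> {}"
    unfolding ex_in_conv[symmetric] split_paired_Ex
      dual_solutions_iff_kuhn_tucker_set[OF refl] Z_iff by blast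
  have primal_nonempty: "?Z \<noteq> {} \<longrightarrow> ?PP \<noteq> {}"
    using Z_subset by blast
  have B_mono: "monotone_op (G k) (?B k)" if "k \<in> K" for k
    using B[OF that] by (simp add: maximally_monotone_def)
  have converse: "(is_singleton I
         \<or> (\<forall>k\<in>K. at_most_single_valued (G k) (?T k))
         \<or> (\<forall>k\<in>K. strictly_monotone_op (G k) (inverse_op (G k) (?D k)))
         \<or> (I \<subseteq> K \<and> (\<forall>k\<in>K - I. at_most_single_valued (G k) (?T k)) \<and>
            (\<forall>i\<in>I. \<forall>k\<in>I. k \<noteq> i \<longrightarrow> (\<forall>x\<in>H i. L k i x = 0))))
        \<longrightarrow> ?PP \<noteq> {} \<longrightarrow> ?Z \<noteq> {}"
    using kuhn_tucker_set_nonempty_of_primal[OF I_nonempty H conjunct1[OF G] L r B_mono refl] by (intro impI)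
  show ?thesis
    unfolding Let_def
    by (intro conjI maximal zer zer_Z Z_subset dual_nonempty zer_nonempty primal_nonempty converse)
qed

end
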